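(* Consider the pointwise-delay system (P) described in the context, with given continuous initial data $x_{i,0}:[-\bar\tau,0]\to\mathbb{R}^d$, $i=0,1,\dots,N$, and let $$R:=\max_{s\in[-\bar\tau,0]}\ \max_{i=0,1,\dots,N}|x_{i,0}(s)|,\qquad R_\gamma:=\gamma L R+\gamma+1 .$$ Assume that $$\bar\tau<\ln\left(1+\frac{\gamma\,\phi(2R)}{\gamma(1+2\gamma)\phi(2R)+4(1+\gamma)R_\gamma}\right)\qquad\text{and}\qquad \phi\left(\frac{\delta}{2}\right)>\frac1{2\gamma}.$$ Then for any $\bar x\in\mathbb{R}^d$ there exists an admissible control $u$ which steers all agents to $\bar x$, namely such that the corresponding solution of (P) satisfies $$\lim_{t\to+\infty}x_i(t)=\bar x\qquad\text{for any } i\in\{0,1,\dots,N\}.$$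
   Context: Setting. $N,d\in\mathbb{N}$, $|\cdot|$ is the Euclidean norm on $\mathbb{R}^d$, $\gamma>0$ and $\bar\tau>0$ are constants. The delay $\tau:[0,+\infty)\to[0,+\infty)$ is continuous with $\tau(t)\le\bar\tau$ for all $t\ge0$. The function $a:[0,+\infty)\to[0,+\infty)$ is continuous and non-increasing, with $a(s)=1$ for $s\in[0,\delta]$ and $a(s)=0$ for $s\ge r$, where $r>\delta>0$. The function $\phi:[0,+\infty)\to(0,+\infty)$ is non-increasing and Lipschitz continuous with Lipschitz constant $L>0$, and $\phi(0)=1$. System (P): $x_0$ (leader) and $x_1,\dots,x_N$ (agents) are $\mathbb{R}^d$-valued functions with, for $t\ge0$ and $i=1,\dots,N$, $$\frac{dx_0}{dt}(t)=u(t),$$ $$\frac{dx_i}{dt}(t)=\frac1N\sum_{j\in\{1,\dots,N\},\,j\ne i}a_{ij}(t)\,(x_j(t-\tau(t))-x_i(t))+\gamma\,\phi(|x_0(t-\tau(t))-x_i(t)|)\,(x_0(t-\tau(t))-x_i(t)),$$ where $a_{ij}(t)=a(|x_j(t-\tau(t))-x_i(t)|)$, and with prescribed continuous initial data $x_i(s)=x_{i,0}(s)$, $s\in[-\bar\tau,0]$, $i=0,1,\dots,N$. A solution consists of continuous functions on $[-\bar\tau,+\infty)$, locally absolutely continuous on $[0,+\infty)$, satisfying the equations for almost every $t\ge0$. Well-posedness of the system for continuous initial data is taken as known. A measurable control $u:[0,+\infty)\to\mathbb{R}^d$ is admissible if there exists a constant $M>0$ such that $\|u\|_{L^\infty}\le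 M$. *)

theory Defs
  imports "HOL-Analysis.Analysis" "HOL-Probability.Essential_Supremum"
begin

text \<open>The members \<^term>\<open>k\<close> of a division are finitely many non-overlapping compact intervals
  \<^term>\<open>{Inf k..Sup k}\<close>, so this is the usual epsilon-delta definition of absolute continuity
  (intended for \<^term>\<open>S\<close> an interval).\<close>

definition absolutely_continuous_on :: "real set \<Rightarrow> (real \<Rightarrow> 'a::real_normed_vector) \<Rightarrow> bool"
  where "absolutely_continuous_on S f \<longleftrightarrow>
    (\<forall>\<epsilon>>0. \<exists>\<eta>>0. \<forall>D. D division_of (\<Union>D) \<and> \<Union>D \<subseteq> S \<and> (\<Sum>k\<in>D. Sup k - Inf k) < \<eta> \<longrightarrow>
        (\<Sum>k\<in>D. norm (f (Sup k) - f (Inf k))) < \<epsilon>)"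

definition locally_absolutely_continuous :: "(real \<Rightarrow> 'a::real_normed_vector) \<Rightarrow> bool"
  where "locally_absolutely_continuous f \<longleftrightarrow> (\<forall>T\<ge>0. absolutely_continuous_on {0..T} f)"

definition admissible_control :: "(real \<Rightarrow> 'a::euclidean_space) \<Rightarrow> bool"
  where "admissible_control u \<longleftrightarrow>
    u \<in> borel_measurable (lebesgue_on {0..}) \<and>
    (\<exists>M>0. esssup (lebesgue_on {0..}) (\<lambda>t. ereal (norm (u t))) \<le> ereal M)"

text \<open>Index 0 is the leader, indices 1 to \<^term>\<open>N\<close> are the agents. All functions are total on
  \<^typ>\<open>real\<close>: trajectories matter only on \<^term>\<open>{-\<tau>b..}\<close>, initial data only on
  \<^term>\<open>{-\<tau>b..0}\<close>, and delay, control and interaction functions only on \<^term>\<open>{0..}\<close>,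
  where \<^term>\<open>\<tau>b\<close> is the bound on the delay.\<close>

definition agent_velocity ::
  "nat \<Rightarrow> real \<Rightarrow> (real \<Rightarrow> real) \<Rightarrow> (real \<Rightarrow> real) \<Rightarrow> (real \<Rightarrow> real) \<Rightarrow>
   (nat \<Rightarrow> real \<Rightarrow> 'a::real_normed_vector) \<Rightarrow> nat \<Rightarrow> real \<Rightarrow> 'a"
  where "agent_velocity N \<gamma> \<tau> a \<phi> x i t =
    (1 / real N) *\<^sub>R (\<Sum>j\<in>{1..N} - {i}. a (norm (x j (t - \<tau> t) - x i t)) *\<^sub>R (x j (t - \<tau> t) - x i t))
    + (\<gamma> * \<phi> (norm (x 0 (t - \<tau> t) - x i t))) *\<^sub>R (x 0 (t - \<tau> t) - x i t)"

definition solves_P ::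
  "nat \<Rightarrow> real \<Rightarrow> real \<Rightarrow> (real \<Rightarrow> real) \<Rightarrow> (real \<Rightarrow> real) \<Rightarrow> (real \<Rightarrow> real) \<Rightarrow>
   (nat \<Rightarrow> real \<Rightarrow> 'a::real_normed_vector) \<Rightarrow> (real \<Rightarrow> 'a) \<Rightarrow> (nat \<Rightarrow> real \<Rightarrow> 'a) \<Rightarrow> bool"
  where "solves_P N \<gamma> \<tau>b \<tau> a \<phi> x_init u x \<longleftrightarrow>
    (\<forall>i\<le>N. continuous_on {-\<tau>b..} (x i) \<and> locally_absolutely_continuous (x i) \<and>
           (\<forall>s\<in>{-\<tau>b..0}. x i s = x_init i s)) \<and>
    (AE t in lebesgue_on {0..}. (x 0 has_vector_derivative u t) (at t within {0..})) \<and>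
    (\<forall>i\<in>{1..N}. AE t in lebesgue_on {0..}.
       (x i has_vector_derivative agent_velocity N \<gamma> \<tau> a \<phi> x i t) (at t within {0..}))"

text \<open>The outer supremum is attained whenever the initial data are continuous.\<close>

definition initial_radius :: "nat \<Rightarrow> real \<Rightarrow> (nat \<Rightarrow> real \<Rightarrow> 'a::real_normed_vector) \<Rightarrow> real"
  where "initial_radius N \<tau>b x_init = (SUP s\<in>{-\<tau>b..0}. MAX i\<in>{0..N}. norm (x_init i s))"

end

theory Submission
  imports Defs "HOL-Complex_Analysis.Great_Picard" "HOL-Real_Asymp.Real_Asymp"
begin

text \<open>
  The control moves the leader along the segment from its initial position to the target \<open>xbar\<close> in
  one unit of time and switches off afterwards, so that the leader rests at \<open>xbar\<close> from time 1 on.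
  What makes this steer the agents is a maximum principle. Fix a point \<open>p\<close> and suppose that at
  time \<open>t\<close> an agent is at distance \<open>m\<close> from \<open>p\<close>, while the delayed positions of the others are
  within \<open>m'\<close>, where \<open>m \<le> m'\<close>. The total weight of the other agents is at most 1, so that they
  push the agent outwards at a rate of at most \<open>m' - m\<close>, and the leader, when it rests at \<open>p\<close>,
  pulls it inwards at the rate \<open>\<gamma> * \<phi> m * m\<close> (lemma \<open>velocity_inner_le\<close>).

  With \<open>p = 0\<close> and \<open>m' = m\<close> this confines all agents to any ball around the origin that contains
  the initial data and the leader in its interior (\<open>agents_bounded\<close>). With \<open>p = xbar\<close> the
  distances stay in a fixed bounded range, the influence \<open>\<phi>\<close> is bounded below there by some
  \<open>c > 0\<close>, and the exponential \<open>v t = C * exp (- l * t)\<close> is, up to a shift of time, a barrier: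
  looking back by at most \<open>\<tau>b\<close> costs the factor \<open>exp (l * \<tau>b)\<close>, and for small \<open>l\<close> the inequality
  \<open>exp (l * \<tau>b) - 1 - \<gamma> * c < - l\<close> says that a trajectory touching the barrier falls faster than
  the barrier does. Hence all agents converge exponentially to \<open>xbar\<close> (\<open>agents_converge\<close>). Both
  steps are instances of one first-contact argument (\<open>norm_below_barrier\<close>).

  Two analytic facts connect this with the notion of solution. First, solutions are only locally
  absolutely continuous with derivatives prescribed almost everywhere; the fundamental theorem of
  calculus for absolutely continuous functions (\<open>absolutely_continuous_imp_has_integral\<close>)
  identifies the leader with the prescribed path and shows that the agents, whose velocities are
  continuous, satisfy their equations at every time. Secondly, the interaction \<open>a\<close> is merely
  continuous and the delay may vanish, so the velocity field may fail to be Lipschitz and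
  solutions may fail to be unique. Existence is therefore of Peano type: an artificial extra delay makes the system
  explicitly solvable, and a limit of subsequences removes it (\<open>peano_existence\<close>). For the same
  reason the convergence argument speaks about an arbitrary solution and not only about the
  constructed one.
\<close>

section \<open>The fundamental theorem of calculus for absolutely continuous functions\<close>

lemma increment_straddle:
  fixes f :: "real \<Rightarrow> 'a::real_normed_vector"
  assumes d: "\<And>y. \<lbrakk>y \<in> S; \<bar>y - x\<bar> < d\<rbrakk> \<Longrightarrow> norm (f y - f x - (y - x) *\<^sub>R f') \<le> e * \<bar>y - x\<bar>"
    and uv: "u \<le> x" "x \<le> v" and S: "u \<in> S" "v \<in> S" and "\<bar>u - x\<bar> < d" "\<bar>v - x\<bar> < d"
  shows "norm ((v - u) *\<^sub>R f' - (f v - f u)) \<le> e * (v - u)"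
proof -
  have "(v - u) *\<^sub>R f' - (f v - f u)
      = (f u - f x - (u - x) *\<^sub>R f') - (f v - f x - (v - x) *\<^sub>R f')"
    by (simp add: algebra_simps)
  also have "norm \<dots> \<le> e * \<bar>u - x\<bar> + e * \<bar>v - x\<bar>"
    using d[OF \<open>u \<in> S\<close> \<open>\<bar>u - x\<bar> < d\<close>] d[OF \<open>v \<in> S\<close> \<open>\<bar>v - x\<bar> < d\<close>]
    by (intro order_trans[OF norm_triangle_ineq4]) linarith
  also have "\<dots> = e * (v - u)" using uv by (simp add: algebra_simps)
  finally show ?thesis .
qed

lemma null_set_outer_open:
  fixes E :: "'a::euclidean_space set"
  assumes neg: "negligible E" and "\<eta> > 0"
  obtains U where "open U" "E \<subseteq> U" "U \<in> lmeasurable" "measure lebesgue U < \<eta>"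
proof -
  have "E \<in> sets lebesgue" using neg by (simp add: negligible_imp_sets)
  then obtain U where U: "open U" "E \<subseteq> U" "U - E \<in> lmeasurable" "emeasure lebesgue (U - E) < ennreal \<eta>"
    using sets_lebesgue_outer_open \<open>\<eta> > 0\<close> by blast
  have E: "E \<in> lmeasurable" "measure lebesgue E = 0"
    using neg by (auto simp: negligible_imp_measurable negligible_imp_measure0)
  have UE: "U = (U - E) \<union> E" using U by blast
  have m: "measure lebesgue (U - E) < \<eta>"
    using U(3,4) \<open>\<eta> > 0\<close> by (simp add: emeasure_eq_measure2 ennreal_less_iff)
  have "U \<in> lmeasurable"
    by (subst UE) (intro fmeasurable.Un U E)
  moreover have "measure lebesgue U \<le> measure lebesgue (U - E) + measure lebesgue E"
    using U(3) E by (subst UE) (intro measure_Un_le fmeasurableD)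
  ultimately show thesis using that[of U] U m E by simp
qed

text \<open>The gauge is chosen according to the tag. At a tag outside the exceptional set the straddle
  estimate makes the increment of \<open>f\<close> agree with \<open>g\<close> times the length up to a small multiple of
  the length. The intervals tagged in the exceptional set lie in an open set of small measure, so
  that absolute continuity makes the sum of the increments over them small, and setting the
  integrand to 0 on that null set leaves nothing else to estimate.\<close>

theorem absolutely_continuous_imp_has_integral:
  fixes f :: "real \<Rightarrow> 'a::banach"
  assumes ac: "absolutely_continuous_on {a..b} f" and ab: "a \<le> b" and neg: "negligible E"
    and der: "\<And>x. x \<in> {a..b} - E \<Longrightarrow> (f has_vector_derivative g x) (at x within {a..b})"
  shows "(g has_integral f b - f a) {a..b}"
proof -
  define g0 where "g0 x = (if x \<in> E then 0 else g x)" for x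
  have "(g0 has_integral f b - f a) {a..b}"
    unfolding has_integral_real
  proof (intro allI impI)
    fix e0 :: real
    assume "e0 > 0"
    \<comment> \<open>Half of the error \<open>e0\<close> goes to each kind of tag; the 1 covers the case \<open>a = b\<close>.\<close>
    define e where "e = e0 / (2 * (1 + (b - a)))"
    have e: "e > 0" "e * (b - a) < e0 / 2"
      using \<open>e0 > 0\<close> ab by (auto simp: e_def field_simps)
    have "e0 / 2 > 0" using \<open>e0 > 0\<close> by simp
    then obtain \<eta> where \<eta>: "\<eta> > 0" "\<And>D. \<lbrakk>D division_of (\<Union>D); \<Union>D \<subseteq> {a..b}; (\<Sum>k\<in>D. Sup k - Inf k) < \<eta>\<rbrakk>
        \<Longrightarrow> (\<Sum>k\<in>D. norm (f (Sup k) - f (Inf k))) < e0 / 2"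
      using ac unfolding absolutely_continuous_on_def by meson
    obtain U where U: "open U" "E \<subseteq> U" "U \<in> lmeasurable" "measure lebesgue U < \<eta>"
      using null_set_outer_open[OF neg \<eta>(1)] by blast
    have "\<forall>x. \<exists>d>0. (x \<in> {a..b} - E \<longrightarrow>
         (\<forall>y\<in>{a..b}. \<bar>y - x\<bar> < d \<longrightarrow> norm (f y - f x - (y-x) *\<^sub>R g x) \<le> e * \<bar>y - x\<bar>))
         \<and> (x \<in> E \<longrightarrow> ball x d \<subseteq> U)"
    proof
      fix x
      consider "x \<in> E" | "x \<in> {a..b} - E" | "x \<notin> E" "x \<notin> {a..b}" by blast
      then show "\<exists>d>0. (x \<in> {a..b} - E \<longrightarrow>
         (\<forall>y\<in>{a..b}. \<bar>y - x\<bar> < d \<longrightarrow> norm (f y - f x - (y-x) *\<^sub>R g x) \<le> e * \<bar>y - x\<bar>))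
         \<and> (x \<in> E \<longrightarrow> ball x d \<subseteq> U)"
      proof cases
        case 1
        then obtain d where "d > 0" "ball x d \<subseteq> U" using U(1,2) openE by blast
        with 1 show ?thesis by (intro exI[of _ d]) auto
      next
        case 2
        obtain d where "d > 0"
          "\<forall>y\<in>{a..b}. norm (y - x) < d \<longrightarrow> norm (f y - f x - (y - x) *\<^sub>R g x) \<le> e * norm (y - x)"
          using der[OF 2] e(1) unfolding has_vector_derivative_def has_derivative_within_alt by blast
        with 2 show ?thesis by (intro exI[of _ d]) auto
      next
        case 3
        then show ?thesis by (intro exI[of _ 1]) auto
      qed
    qed
    then obtain d where d: "\<And>x. 0 < d x"
        "\<And>x y. \<lbrakk>x \<in> {a..b} - E; y \<in> {a..b}; \<bar>y - x\<bar> < d x\<rbrakk> \<Longrightarrow> norm (f y - f x - (y-x) *\<^sub>R g x) \<le> e * \<bar>y - x\<bar>"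
        "\<And>x. x \<in> E \<Longrightarrow> ball x (d x) \<subseteq> U"
      by metis
    show "\<exists>\<gamma>. gauge \<gamma> \<and> (\<forall>p. p tagged_division_of {a..b} \<and> \<gamma> fine p \<longrightarrow>
        norm ((\<Sum>(x, k)\<in>p. measure lborel k *\<^sub>R g0 x) - (f b - f a)) < e0)"
    proof (rule exI, intro conjI allI impI; (elim conjE)?)
      show "gauge (\<lambda>x. ball x (d x))"
        using d(1) gauge_ball_dependent by blast
      fix p
      assume ptag: "p tagged_division_of {a..b}" and fine: "(\<lambda>x. ball x (d x)) fine p"
      have K: "\<exists>u v. K = {u..v} \<and> u \<le> x \<and> x \<le> v \<and> {u..v} \<subseteq> {a..b} \<and> {u..v} \<subseteq> ball x (d x)"
        if xK: "(x, K) \<in> p" for x K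
        
      proof -
        obtain u v where "K = cbox u v" using tagged_division_ofD(4)[OF ptag xK] by blast
        then show ?thesis
          using tagged_division_ofD(2,3)[OF ptag xK] fineD[OF fine xK]
          by (intro exI[of _ u] exI[of _ v]) auto
      qed
      define T where "T = (\<lambda>(x, K). measure lborel K *\<^sub>R g0 x - (f (Sup K) - f (Inf K)))"
      have fin: "finite p" using ptag by blast
      define q where "q = {z \<in> p. fst z \<in> E}"
      have q: "q \<subseteq> p" by (auto simp: q_def)
      have qdiv: "q tagged_division_of \<Union>(snd ` q)"
        
      proof (rule tagged_partial_division_of_Union_self)
        have "p tagged_partial_division_of {a..b}" using ptag by (simp add: tagged_division_of_def)
        then show "q tagged_partial_division_of {a..b}" by (rule tagged_partial_division_subset[OF _ q])
      qed
      have good: "norm (T z) \<le> e * (Sup (snd z) - Inf (snd z))" if "z \<in> p - q" for z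
      proof -
        obtain x K where z: "z = (x, K)" by fastforce
        with that have xK: "(x, K) \<in> p" "x \<notin> E" by (auto simp: q_def)
        obtain u v where uv: "K = {u..v}" "u \<le> x" "x \<le> v" "{u..v} \<subseteq> {a..b}" "{u..v} \<subseteq> ball x (d x)"
          using K[OF xK(1)] by blast
        have *: "u \<in> {u..v}" "v \<in> {u..v}" "x \<in> {u..v}" using uv by auto
        have x: "x \<in> {a..b} - E" using * uv(4) xK(2) by blast
        have "u \<in> ball x (d x)" "v \<in> ball x (d x)" using * uv(5) by blast+
        then have d': "\<bar>u - x\<bar> < d x" "\<bar>v - x\<bar> < d x" by (simp_all add: dist_real_def)
        have "norm ((v - u) *\<^sub>R g x - (f v - f u)) \<le> e * (v - u)"
          by (rule increment_straddle[where S = "{a..b}", OF d(2)[OF x] uv(2,3) _ _ d'])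
            (use * uv(4) in auto)
        then show ?thesis using uv xK by (simp add: z T_def g0_def)
      qed
      have bad: "norm (T z) = norm (f (Sup (snd z)) - f (Inf (snd z)))" if "z \<in> q" for z
        using that by (auto simp: q_def T_def g0_def norm_minus_commute split: prod.splits)
      have "(\<Sum>K\<in>snd ` q. Sup K - Inf K) = (\<Sum>K\<in>snd ` q. measure lebesgue K)"
      proof (rule sum.cong)
        fix k assume "k \<in> snd ` q"
        then obtain x where "(x, k) \<in> p" using q by auto
        from K[OF this] show "Sup k - Inf k = measure lebesgue k" by auto
      qed simp
      also have "\<dots> = measure lebesgue (\<Union>(snd ` q))"
        using content_division[OF division_of_tagged_division[OF qdiv]] by simp
      also have "\<dots> \<le> measure lebesgue U"
      proof (rule measure_mono_fmeasurable)
        show "\<Union>(snd ` q) \<subseteq> U"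
        proof safe
          fix x K z assume "(x, K) \<in> q" "z \<in> snd (x, K)"
          then have "(x, K) \<in> p" "x \<in> E" "z \<in> K" by (auto simp: q_def)
          with K[OF this(1)] d(3)[OF this(2)] show "z \<in> U" by blast
        qed
        show "\<Union>(snd ` q) \<in> sets lebesgue"
          using lmeasurable_division[OF division_of_tagged_division[OF qdiv]] by blast
      qed (use U in auto)
      also have "\<dots> < \<eta>" by (rule U)
      finally have small: "(\<Sum>K\<in>snd ` q. Sup K - Inf K) < \<eta>" .
      have badsum: "(\<Sum>z\<in>q. norm (T z)) < e0 / 2"
      proof -
        \<comment> \<open>Absolute continuity speaks of sums over sets of intervals, and passing from tagged intervals
          to these needs a summand that vanishes on degenerate intervals. The empty set never occurs
          in \<open>q\<close>, but \<open>Sup\<close> and \<open>Inf\<close> are unspecified there, hence the case distinction.\<close>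
        define w where "w K = (if K = {} then 0 else norm (f (Sup K) - f (Inf K)))" for K
        have ne: "K \<noteq> {}" if "(x, K) \<in> q" for x K
        proof -
          have "(x, K) \<in> p" using q that by blast
          from K[OF this] show ?thesis by auto
        qed
        have "(\<Sum>z\<in>q. norm (T z)) = (\<Sum>(x,K)\<in>q. w K)"
          using bad ne by (intro sum.cong) (auto simp: w_def)
        also have "\<dots> = (\<Sum>K\<in>snd ` q. w K)"
        proof (rule sum.over_tagged_division_lemma[OF qdiv])
          fix u v :: real
          assume "box u v = {}"
          then have "v \<le> u" by auto
          then show "w (cbox u v) = 0" by (cases "u = v") (auto simp: w_def)
        qed
        also have "\<dots> = (\<Sum>K\<in>snd ` q. norm (f (Sup K) - f (Inf K)))"
          using ne by (intro sum.cong) (auto simp: w_def)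
        also have "\<dots> < e0 / 2"
        proof (rule \<eta>(2))
          show "snd ` q division_of \<Union>(snd ` q)" by (rule division_of_tagged_division[OF qdiv])
          show "\<Union>(snd ` q) \<subseteq> {a..b}"
          proof safe
            fix x K z assume "(x, K) \<in> q" "z \<in> snd (x, K)"
            then have "(x, K) \<in> p" "z \<in> K" by (auto simp: q_def)
            with K[OF this(1)] show "z \<in> {a..b}" by blast
          qed
        qed (rule small)
        finally show ?thesis .
      qed
      have "(\<Sum>z\<in>p - q. norm (T z)) \<le> (\<Sum>z\<in>p - q. e * (Sup (snd z) - Inf (snd z)))"
        using good by (rule sum_mono)
      also have "\<dots> \<le> (\<Sum>z\<in>p. e * (Sup (snd z) - Inf (snd z)))"
      proof (rule sum_mono2[OF fin])
        fix z assume "z \<in> p - (p - q)"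
        then have "(fst z, snd z) \<in> p" by simp
        from K[OF this] e(1) show "0 \<le> e * (Sup (snd z) - Inf (snd z))" by auto
      qed simp
      also have "\<dots> = e * (b - a)"
        using additive_tagged_division_1[OF ab ptag, of "\<lambda>x. x"]
        by (simp add: sum_distrib_left[symmetric] split_beta)
      finally have goodsum: "(\<Sum>z\<in>p - q. norm (T z)) \<le> e * (b - a)" .
      have "(\<Sum>(x, k)\<in>p. measure lborel k *\<^sub>R g0 x) - (f b - f a) = (\<Sum>z\<in>p. T z)"
        using additive_tagged_division_1[OF ab ptag, of f]
        by (simp add: T_def split_beta sum_subtractf)
      also have "norm \<dots> \<le> (\<Sum>z\<in>p. norm (T z))" by (rule norm_sum)
      also have "\<dots> = (\<Sum>z\<in>p - q. norm (T z)) + (\<Sum>z\<in>q. norm (T z))"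
        by (rule sum.subset_diff[OF q fin])
      also have "\<dots> < e0" using goodsum badsum e(2) by linarith
      finally show "norm ((\<Sum>(x, k)\<in>p. measure lborel k *\<^sub>R g0 x) - (f b - f a)) < e0" .
    qed
  qed
  then show ?thesis
    by (rule has_integral_spike[OF neg, rotated]) (simp add: g0_def)
qed

lemma lipschitz_imp_absolutely_continuous:
  fixes f :: "real \<Rightarrow> 'a::real_normed_vector"
  assumes "B-lipschitz_on S f"
  shows "absolutely_continuous_on S f"
  unfolding absolutely_continuous_on_def
proof (intro allI impI)
  fix \<epsilon> :: real assume "\<epsilon> > 0"
  have B: "B \<ge> 0" using assms by (rule lipschitz_on_nonneg)
  show "\<exists>\<eta>>0. \<forall>D. D division_of \<Union>D \<and> \<Union>D \<subseteq> S \<and> (\<Sum>k\<in>D. Sup k - Inf k) < \<eta> \<longrightarrow>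
      (\<Sum>k\<in>D. norm (f (Sup k) - f (Inf k))) < \<epsilon>"
  proof (intro exI[of _ "\<epsilon> / (B + 1)"] conjI allI impI; (elim conjE)?)
    show "\<epsilon> / (B + 1) > 0" using \<open>\<epsilon> > 0\<close> B by simp
    fix D assume D: "D division_of \<Union>D" "\<Union>D \<subseteq> S" and small: "(\<Sum>k\<in>D. Sup k - Inf k) < \<epsilon> / (B + 1)"
    have k: "\<exists>u v. k = {u..v} \<and> u \<le> v \<and> u \<in> S \<and> v \<in> S" if kD: "k \<in> D" for k
      using division_ofD(2-4)[OF D(1) kD] D(2) that 
    proof -
      obtain u v where "k = cbox u v" using division_ofD(4)[OF D(1) kD] by blast
      moreover have "k \<noteq> {}" "k \<subseteq> S" using division_ofD(3)[OF D(1) kD] D(2) kD by auto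
      ultimately show ?thesis
        by (intro exI[of _ u] exI[of _ v]) (auto simp: subset_iff)
    qed
    have "(\<Sum>k\<in>D. norm (f (Sup k) - f (Inf k))) \<le> (\<Sum>k\<in>D. (B + 1) * (Sup k - Inf k))"
    proof (rule sum_mono)
      fix k assume "k \<in> D"
      then obtain u v where uv: "k = {u..v}" "u \<le> v" "u \<in> S" "v \<in> S" using k by blast
      then have "norm (f v - f u) \<le> B * (v - u)"
        using lipschitz_onD[OF assms, of v u] by (simp add: dist_norm)
      then show "norm (f (Sup k) - f (Inf k)) \<le> (B + 1) * (Sup k - Inf k)"
        using uv by (simp add: algebra_simps)
    qed
    also have "\<dots> = (B + 1) * (\<Sum>k\<in>D. Sup k - Inf k)" by (simp add: sum_distrib_left)
    also have "\<dots> < \<epsilon>" using small B by (simp add: field_simps)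
    finally show "(\<Sum>k\<in>D. norm (f (Sup k) - f (Inf k))) < \<epsilon>" .
  qed
qed

lemma AE_lebesgue_on_iff_negligible:
  assumes "S \<in> sets lebesgue"
  shows "(AE t in lebesgue_on S. P t) \<longleftrightarrow> (\<exists>E. negligible E \<and> (\<forall>t\<in>S - E. P t))"
proof -
  have "(AE t in lebesgue_on S. P t) \<longleftrightarrow> (AE t in lebesgue. t \<in> S \<longrightarrow> P t)"
    using assms by (intro AE_restrict_space_iff) auto
  also have "\<dots> \<longleftrightarrow> (\<exists>E. negligible E \<and> (\<forall>t\<in>S - E. P t))"
    unfolding eventually_ae_filter_negligible by blast
  finally show ?thesis .
qed

lemma locally_absolutely_continuous_has_integral:
  fixes f :: "real \<Rightarrow> 'a::banach"
  assumes ac: "locally_absolutely_continuous f"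
    and der: "AE t in lebesgue_on {0..}. (f has_vector_derivative g t) (at t within {0..})"
    and t: "t \<ge> 0"
  shows "(g has_integral f t - f 0) {0..t}"
proof -
  obtain E where E: "negligible E"
    "\<And>t. t \<in> {0..} - E \<Longrightarrow> (f has_vector_derivative g t) (at t within {0..})"
    using der by (auto simp: AE_lebesgue_on_iff_negligible)
  show ?thesis
  proof (rule absolutely_continuous_imp_has_integral[OF _ t E(1)])
    show "absolutely_continuous_on {0..t} f"
      using ac t by (simp add: locally_absolutely_continuous_def)
    show "(f has_vector_derivative g s) (at s within {0..t})" if "s \<in> {0..t} - E" for s
      using E(2)[of s] that by (auto intro: has_vector_derivative_within_subset)
  qed
qed

lemma lipschitz_imp_locally_absolutely_continuous:
  assumes "B-lipschitz_on {0..} f"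
  shows "locally_absolutely_continuous f"
  unfolding locally_absolutely_continuous_def
  by (intro allI impI lipschitz_imp_absolutely_continuous[where B = B] lipschitz_on_subset[OF assms]) auto

section \<open>Indefinite integrals of bounded continuous functions\<close>

lemma lipschitz_indefinite_integral:
  fixes g :: "real \<Rightarrow> 'a::euclidean_space"
  assumes cont: "continuous_on {0..} g" and bd: "\<And>t. t \<ge> 0 \<Longrightarrow> norm (g t) \<le> B"
  shows "B-lipschitz_on UNIV (\<lambda>t. integral {0..t} g)"
proof -
  have B: "B \<ge> 0" using bd[of 0] norm_ge_zero order_trans by blast
  have int: "g integrable_on {s..t}" if "s \<ge> 0" for s t
    using that by (intro integrable_continuous_real continuous_on_subset[OF cont]) auto
  have le: "norm (integral {0..t} g - integral {0..s} g) \<le> B * (t - s)" if "s \<le> t" for s t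
  proof (cases "s \<ge> 0")
    case True
    then have "integral {0..t} g - integral {0..s} g = integral {s..t} g"
      using Henstock_Kurzweil_Integration.integral_combine[OF True that int[of 0 t]] by (simp add: algebra_simps)
    then show ?thesis
      using integral_bound[OF that, of g B] True bd continuous_on_subset[OF cont, of "{s..t}"] by auto
  next
    case s: False
    show ?thesis
    proof (cases "t \<ge> 0")
      case True
      then have "norm (integral {0..t} g) \<le> B * (t - 0)"
        using bd continuous_on_subset[OF cont, of "{0..t}"] by (intro integral_bound) auto
      also have "\<dots> \<le> B * (t - s)" using B s by (intro mult_left_mono) auto
      finally show ?thesis using s by simp
    qed (use s B that in auto)
  qed
  show ?thesis
  proof (rule lipschitz_onI[OF _ B])
    fix s t
    show "dist (integral {0..s} g) (integral {0..t} g) \<le> B * dist s t"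
      using le[of s t] le[of t s] by (cases "s \<le> t") (auto simp: dist_norm norm_minus_commute abs_if)
  qed
qed

lemma indefinite_integral_has_vector_derivative:
  fixes g :: "real \<Rightarrow> 'a::euclidean_space"
  assumes cont: "continuous_on {0..} g" and t: "t \<ge> 0"
    and x: "\<And>s. s \<ge> 0 \<Longrightarrow> x s = c + integral {0..s} g"
  shows "(x has_vector_derivative g t) (at t within {0..})"
proof -
  have "((\<lambda>s. integral {0..s} g) has_vector_derivative g t) (at t within {0..t + 1})"
    using t by (intro integral_has_vector_derivative continuous_on_subset[OF cont]) auto
  then have "((\<lambda>s. c + integral {0..s} g) has_vector_derivative g t) (at t within {0..t + 1})"
    using has_vector_derivative_add[OF has_vector_derivative_const[of c]] by fastforce
  moreover have "at t within {0..t + 1} = at t within {0..}"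
    by (rule at_within_nhd[of _ "{..<t + 1}"]) auto
  ultimately have "((\<lambda>s. c + integral {0..s} g) has_vector_derivative g t) (at t within {0..})"
    by simp
  then show ?thesis
    by (rule has_vector_derivative_transform[rotated 2]) (use x t in auto)
qed

section \<open>First contact with a barrier\<close>

text \<open>At a first contact time some norm touches the barrier from below. There the derivative of
  \<open>norm (y i t) ^ 2 - v t ^ 2\<close> is negative by assumption, so this difference was already positive
  shortly before, which contradicts the choice of the time. The hypothesis \<open>touch\<close> may use that
  all norms have stayed below the barrier so far, as is needed for delayed couplings.\<close>

lemma norm_below_barrier:
  fixes y :: "'i \<Rightarrow> real \<Rightarrow> 'a::real_inner" and v :: "real \<Rightarrow> real"
  assumes fin: "finite I"
    and cont: "\<And>i. i \<in> I \<Longrightarrow> continuous_on {t0..} (y i)"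
    and vpos: "\<And>t. t \<ge> t0 \<Longrightarrow> v t > 0"
    and vder: "\<And>t. t \<ge> t0 \<Longrightarrow> (v has_real_derivative v' t) (at t)"
    and yder: "\<And>i t. \<lbrakk>i \<in> I; t > t0\<rbrakk> \<Longrightarrow> (y i has_vector_derivative y' i t) (at t)"
    and init: "\<And>i. i \<in> I \<Longrightarrow> norm (y i t0) < v t0"
    and touch: "\<And>i t. \<lbrakk>i \<in> I; t > t0; norm (y i t) = v t; \<And>j s. \<lbrakk>j \<in> I; t0 \<le> s; s \<le> t\<rbrakk> \<Longrightarrow> norm (y j s) \<le> v s\<rbrakk>
        \<Longrightarrow> y i t \<bullet> y' i t < v t * v' t"
    and i: "i \<in> I" and t: "t \<ge> t0"
  shows "norm (y i t) < v t"
proof (rule ccontr)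
  assume "\<not> norm (y i t) < v t"
  define S where "S = (\<Union>j\<in>I. {t0..} \<inter> (\<lambda>s. norm (y j s) - v s) -` {0..})"
  have vcont: "continuous_on {t0..} v"
    using vder by (intro DERIV_continuous_on) (auto intro: has_field_derivative_at_within)
  have "closed S"
    unfolding S_def using fin cont vcont
    by (intro closed_UN ballI continuous_closed_preimage continuous_intros) auto
  moreover have "t \<in> S" unfolding S_def using i t \<open>\<not> norm (y i t) < v t\<close> by (intro UN_I[of i]) auto
  then have "S \<noteq> {}" by blast
  moreover have bdd: "bdd_below S" unfolding S_def by (rule bdd_belowI[of _ t0]) auto
  ultimately have "Inf S \<in> S" by (intro closed_contains_Inf)
  define c where "c = Inf S"
  obtain k where k: "k \<in> I" "c \<ge> t0" "norm (y k c) \<ge> v c"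
    using \<open>Inf S \<in> S\<close> unfolding c_def[symmetric] by (auto simp: S_def)
  have below: "norm (y j s) < v s" if "j \<in> I" "t0 \<le> s" "s < c" for j s
  proof (rule ccontr)
    assume "\<not> norm (y j s) < v s"
    then have "s \<in> S" unfolding S_def using that by (intro UN_I[of j]) auto
    then show False using cInf_lower[OF \<open>s \<in> S\<close> bdd] \<open>s < c\<close> by (simp add: c_def)
  qed
  have "c > t0" using init[OF k(1)] k by (cases "c = t0") auto
  have le: "norm (y j s) \<le> v s" if "j \<in> I" "t0 \<le> s" "s \<le> c" for j s
  proof (cases "s = c")
    case True
    have "((\<lambda>s. v s - norm (y j s)) \<longlongrightarrow> v c - norm (y j c)) (at c within {t0..<c})"
      using continuous_on_subset[OF cont[OF \<open>j \<in> I\<close>], of "{t0..c}"] continuous_on_subset[OF vcont, of "{t0..c}"] \<open>c > t0\<close>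
      by (intro tendsto_intros; force simp: continuous_on_def intro: tendsto_within_subset)
    moreover have "at c within {t0..<c} \<noteq> bot"
      using \<open>c > t0\<close> by (simp add: at_within_eq_bot_iff)
    moreover have "eventually (\<lambda>s. 0 \<le> v s - norm (y j s)) (at c within {t0..<c})"
      using below[OF \<open>j \<in> I\<close>] by (auto simp: eventually_at_filter intro!: always_eventually less_imp_le)
    ultimately have "0 \<le> v c - norm (y j c)"
      using tendsto_lowerbound by blast
    then show ?thesis using True by simp
  qed (use below that in force)
  have eq: "norm (y k c) = v c" using le[OF k(1,2)] k by force
  have neg: "y k c \<bullet> y' k c < v c * v' c"
    by (rule touch[OF k(1) \<open>c > t0\<close> eq le])
  have "((\<lambda>s. y k s \<bullet> y k s - v s * v s) has_real_derivative 2 * (y k c \<bullet> y' k c - v c * v' c)) (at c)"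
  proof -
    have 1: "((\<lambda>s. y k s \<bullet> y k s) has_vector_derivative (y k c \<bullet> y' k c + y' k c \<bullet> y k c)) (at c)"
      by (rule bounded_bilinear.has_vector_derivative[OF bounded_bilinear_inner]) (use yder k \<open>c > t0\<close> in auto)
    have 2: "((\<lambda>s. v s * v s) has_real_derivative (v' c * v c + v' c * v c)) (at c)"
      by (rule DERIV_mult) (use vder[of c] k in auto)
    show ?thesis
      using DERIV_diff[OF 1[folded has_real_derivative_iff_has_vector_derivative] 2]
      by (simp add: inner_commute algebra_simps)
  qed
  from DERIV_neg_dec_left[OF this] neg obtain d where d: "d > 0"
    "\<And>h. \<lbrakk>h > 0; h < d\<rbrakk> \<Longrightarrow> y k c \<bullet> y k c - v c * v c < y k (c - h) \<bullet> y k (c - h) - v (c - h) * v (c - h)"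
    by (auto simp: mult_less_0_iff)
  define h where "h = min d (c - t0) / 2"
  have h: "h > 0" "h < d" "c - h > t0" using \<open>c > t0\<close> d(1) by (auto simp: h_def min_def field_simps)
  have "norm (y k (c - h)) < v (c - h)" using below[OF k(1)] h by simp
  then have "norm (y k (c - h)) * norm (y k (c - h)) < v (c - h) * v (c - h)"
    by (intro mult_strict_mono) (auto intro: le_less_trans[OF norm_ge_zero])
  then have "y k (c - h) \<bullet> y k (c - h) - v (c - h) * v (c - h) < 0"
    by (simp add: power2_norm_eq_inner[symmetric] power2_eq_square)
  moreover have "y k c \<bullet> y k c - v c * v c = 0"
    using eq by (simp add: power2_norm_eq_inner[symmetric] power2_eq_square)
  ultimately show False using d(2)[OF h(1,2)] by simp
qed

section \<open>Peano existence for causal functional differential equations\<close>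

text \<open>A diagonal subsequence converges at all rational times; equicontinuity carries the convergence
  over to all other times. Dividing by \<open>1 + \<bar>t\<bar>\<close> turns the linear growth bound into the uniform
  bound that the diagonal argument asks for.\<close>

lemma equi_lipschitz_convergent_subsequence:
  fixes J :: "nat \<Rightarrow> nat \<Rightarrow> real \<Rightarrow> 'a::euclidean_space"
  assumes lip: "\<And>n i. B-lipschitz_on UNIV (J n i)" and zero: "\<And>n i. J n i 0 = 0"
  obtains k l where "strict_mono (k::nat \<Rightarrow> nat)" "\<And>i t. (\<lambda>n. J (k n) i t) \<longlonglongrightarrow> l i t"
proof -
  define F where "F n z = J n (fst z) (snd z) /\<^sub>R (1 + \<bar>snd z\<bar>)" for n and z :: "nat \<times> real"
  have B: "B \<ge> 0" using lip lipschitz_on_nonneg by blast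
  have d: "norm (J n i s - J n i t) \<le> B * \<bar>s - t\<bar>" for n i s t
    using lipschitz_onD[OF lip, of s t n i] by (simp add: dist_norm)
  have "norm (F n z) \<le> B" for n z
  proof -
    have "norm (J n (fst z) (snd z)) \<le> B * \<bar>snd z\<bar>"
      using d[of n "fst z" "snd z" 0] zero by simp
    also have "\<dots> \<le> B * (1 + \<bar>snd z\<bar>)" using B by (intro mult_left_mono) auto
    finally show ?thesis
      unfolding F_def by (simp add: field_simps)
  qed
  moreover have "countable (UNIV \<times> \<rat> :: (nat \<times> real) set)" by (simp add: countable_rat)
  ultimately obtain k where k: "strict_mono (k::nat\<Rightarrow>nat)"
    "\<And>z. z \<in> UNIV \<times> \<rat> \<Longrightarrow> \<exists>l. (\<lambda>n. F (k n) z) \<longlonglongrightarrow> l"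
    using function_convergent_subsequence[of "UNIV \<times> \<rat>" F B] by metis
  have rat: "Cauchy (\<lambda>n. J (k n) i q)" if q: "q \<in> \<rat>" for i q
  proof -
    obtain l where "(\<lambda>n. F (k n) (i, q)) \<longlonglongrightarrow> l" using k(2)[of "(i, q)"] q by auto
    then have "(\<lambda>n. (1 + \<bar>q\<bar>) *\<^sub>R F (k n) (i, q)) \<longlonglongrightarrow> (1 + \<bar>q\<bar>) *\<^sub>R l"
      by (intro tendsto_intros)
    moreover have "(1 + \<bar>q\<bar>) *\<^sub>R F (k n) (i, q) = J (k n) i q" for n
      by (simp add: F_def)
    ultimately show ?thesis using LIMSEQ_imp_Cauchy by auto
  qed
  have "convergent (\<lambda>n. J (k n) i t)" for i t
  proof -
    have "Cauchy (\<lambda>n. J (k n) i t)"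
    proof (rule metric_CauchyI)
      fix e :: real assume e: "e > 0"
      define \<delta> where "\<delta> = e / (3 * (B + 1))"
      have \<delta>: "\<delta> > 0" using e B by (simp add: \<delta>_def)
      obtain q where q: "q \<in> \<rat>" "t < q" "q < t + \<delta>" using Rats_dense_in_real[of t "t + \<delta>"] \<delta> by auto
      have "B * \<bar>t - q\<bar> \<le> B * \<delta>" using q B by (intro mult_left_mono) auto
      also have "\<dots> < e / 3" using e B by (simp add: \<delta>_def field_simps)
      finally have Bq: "B * \<bar>t - q\<bar> < e / 3" .
      obtain M where M: "\<And>m n. \<lbrakk>m \<ge> M; n \<ge> M\<rbrakk> \<Longrightarrow> dist (J (k m) i q) (J (k n) i q) < e / 3"
        using metric_CauchyD[OF rat[OF q(1), of i], of "e / 3"] e by auto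
      show "\<exists>M. \<forall>m\<ge>M. \<forall>n\<ge>M. dist (J (k m) i t) (J (k n) i t) < e"
      proof (intro exI[of _ M] allI impI)
        fix m n assume "M \<le> m" "M \<le> n"
        have "dist (J (k m) i t) (J (k n) i t)
          \<le> dist (J (k m) i t) (J (k m) i q) + dist (J (k m) i q) (J (k n) i q) + dist (J (k n) i t) (J (k n) i q)"
          using dist_triangle[of "J (k m) i t" "J (k n) i t" "J (k m) i q"]
            dist_triangle[of "J (k m) i q" "J (k n) i t" "J (k n) i q"] by (simp add: dist_commute)
        also have "\<dots> < e"
          using M[OF \<open>M \<le> m\<close> \<open>M \<le> n\<close>] d[of "k m" i t q] d[of "k n" i t q] Bq by (simp add: dist_norm)
        finally show "dist (J (k m) i t) (J (k n) i t) < e" .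
      qed
    qed
    then show ?thesis by (rule Cauchy_convergent)
  qed
  then show thesis
    by (intro that[OF k(1), of "\<lambda>i t. lim (\<lambda>n. J (k n) i t)"]) (simp add: convergent_LIMSEQ_iff)
qed

text \<open>A functional differential equation \<open>x' = V x\<close> with memory: \<open>V x i t\<close> may depend on all values of
  the path \<open>x\<close> up to time \<open>t\<close>. Continuity of \<open>V\<close> is required with respect to pointwise convergence
  of the path on the past, which suits velocities that evaluate the path at finitely many times
  and also forces causality.\<close>

locale bounded_causal_field =
  fixes V :: "(nat \<Rightarrow> real \<Rightarrow> 'a::euclidean_space) \<Rightarrow> nat \<Rightarrow> real \<Rightarrow> 'a" and B :: real
  assumes bounded: "t \<ge> 0 \<Longrightarrow> norm (V x i t) \<le> B"
    and continuous: "(\<And>j. continuous_on UNIV (x j)) \<Longrightarrow> continuous_on {0..} (V x i)"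
    and seq_continuous: "t \<ge> 0 \<Longrightarrow> (\<And>j s. s \<le> t \<Longrightarrow> (\<lambda>n. X n j s) \<longlonglongrightarrow> x j s) \<Longrightarrow>
      (\<lambda>n. V (X n) i t) \<longlonglongrightarrow> V x i t"
begin

lemma causal:
  assumes "t \<ge> 0" "\<And>j s. s \<le> t \<Longrightarrow> x j s = y j s"
  shows "V x i t = V y i t"
proof -
  have "(\<lambda>n. V y i t) \<longlonglongrightarrow> V x i t"
    by (rule seq_continuous) (use assms in auto)
  then show ?thesis by (simp add: LIMSEQ_const_iff)
qed

text \<open>One Picard step for the equation with an extra delay \<open>h\<close>. It determines the path up to time \<open>t\<close>
  from the path up to \<open>t - h\<close>. For negative times the integral is empty and only the history \<open>\<xi>\<close>
  remains.\<close>

definition delayed_step :: "(nat \<Rightarrow> real \<Rightarrow> 'a) \<Rightarrow> real \<Rightarrow> (nat \<Rightarrow> real \<Rightarrow> 'a) \<Rightarrow> nat \<Rightarrow> real \<Rightarrow> 'a"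
  where "delayed_step \<xi> h x i t = \<xi> i (min t 0) + integral {0..t} (V (\<lambda>j s. x j (s - h)) i)"

lemma delayed_field_continuous:
  assumes "\<And>j. continuous_on UNIV (x j)"
  shows "continuous_on {0..} (V (\<lambda>j s. x j (s - h)) i)"
proof (rule continuous)
  fix j
  show "continuous_on UNIV (\<lambda>s. x j (s - h))"
    by (rule continuous_on_compose2[OF assms]) (auto intro!: continuous_intros)
qed

lemma delayed_step_lipschitz:
  assumes "\<And>j. continuous_on UNIV (x j)"
  shows "B-lipschitz_on UNIV (\<lambda>t. delayed_step \<xi> h x i t - \<xi> i (min t 0))"
  using lipschitz_indefinite_integral[OF delayed_field_continuous[OF assms] bounded]
  by (simp add: delayed_step_def)

lemma continuous_clamped:
  assumes "continuous_on UNIV (f :: real \<Rightarrow> 'a)"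
  shows "continuous_on UNIV (\<lambda>t. f (min t 0))"
  by (rule continuous_on_compose2[OF assms]) (auto intro!: continuous_intros)

lemma delayed_step_continuous:
  assumes \<xi>: "\<And>j. continuous_on UNIV (\<xi> j)" and "\<And>j. continuous_on UNIV (x j)"
  shows "continuous_on UNIV (delayed_step \<xi> h x i)"
proof -
  have "continuous_on UNIV (\<lambda>t. (delayed_step \<xi> h x i t - \<xi> i (min t 0)) + \<xi> i (min t 0))"
    by (intro continuous_on_add lipschitz_on_continuous_on[OF delayed_step_lipschitz] continuous_clamped assms)
  then show ?thesis by simp
qed

text \<open>Tonelli's approximation. Because of the extra delay each Picard step extends the interval on
  which the iterates agree by \<open>h\<close>, so finitely many steps solve the delayed equation up to \<open>T\<close>.\<close>

lemma tonelli_approximation: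
  assumes \<xi>: "\<And>j. continuous_on UNIV (\<xi> j)" and h: "h > 0"
  shows "\<exists>x. (\<forall>i. continuous_on UNIV (x i)) \<and>
     (\<forall>i. B-lipschitz_on UNIV (\<lambda>t. x i t - \<xi> i (min t 0))) \<and>
     (\<forall>i. x i 0 = \<xi> i 0) \<and> (\<forall>i. \<forall>t\<le>T. x i t = delayed_step \<xi> h x i t)"
proof -
  define it where "it k = (delayed_step \<xi> h ^^ k) (\<lambda>i t. \<xi> i (min t 0))" for k
  have it_Suc: "it (Suc k) = delayed_step \<xi> h (it k)" for k by (simp add: it_def)
  have cont: "continuous_on UNIV (it k i)" for k i
  proof (induction k arbitrary: i)
    case 0
    show ?case by (simp add: it_def continuous_clamped[OF \<xi>])
  next
    case (Suc k)
    then show ?case unfolding it_Suc by (intro delayed_step_continuous \<xi>)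
  qed
  have stable: "it (Suc k) i t = it k i t" if "t \<le> real k * h" for k i t
    using that
  proof (induction k arbitrary: i t)
    case 0
    then have "t < 0 \<or> t = 0" by auto
    then show ?case by (auto simp: it_def delayed_step_def)
  next
    case (Suc k)
    have "integral {0..t} (V (\<lambda>j s. it (Suc k) j (s - h)) i) = integral {0..t} (V (\<lambda>j s. it k j (s - h)) i)"
    proof (rule integral_cong)
      fix s assume s: "s \<in> {0..t}"
      show "V (\<lambda>j s. it (Suc k) j (s - h)) i s = V (\<lambda>j s. it k j (s - h)) i s"
      proof (rule causal)
        fix j r assume "r \<le> s"
        then have "r - h \<le> real k * h" using s Suc.prems by (auto simp: algebra_simps)
        then show "it (Suc k) j (r - h) = it k j (r - h)" by (rule Suc.IH)
      qed (use s in auto)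
    qed
    then have "delayed_step \<xi> h (it (Suc k)) i t = delayed_step \<xi> h (it k) i t" by (simp add: delayed_step_def)
    then show ?case by (metis it_Suc)
  qed
  obtain k where k: "T / h \<le> real k" using real_arch_simple by blast
  have kT: "T \<le> real k * h" using k h by (simp add: field_simps)
  have kS: "real k * h \<le> real (Suc k) * h" using h by (intro mult_right_mono) auto
  show ?thesis
  proof (intro exI[of _ "it (Suc k)"] conjI allI impI)
    fix i
    show "B-lipschitz_on UNIV (\<lambda>t. it (Suc k) i t - \<xi> i (min t 0))"
      unfolding it_Suc by (rule delayed_step_lipschitz[OF cont])
    show "it (Suc k) i 0 = \<xi> i 0" by (simp add: it_Suc delayed_step_def)
    fix t assume "t \<le> T"
    then have "t \<le> real (Suc k) * h" using kT kS by linarith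
    from stable[OF this, of i] show "it (Suc k) i t = delayed_step \<xi> h (it (Suc k)) i t"
      by (simp add: it_Suc)
  qed (rule cont)
qed

text \<open>The integral parts \<open>J n\<close> of the Tonelli approximations with delays tending to 0 share the
  Lipschitz constant \<open>B\<close>. Hence a subsequence converges pointwise, the shifted paths have the same
  limit, and dominated convergence passes to the limit in the integral equation. The \<open>n\<close>-th
  approximation solves its equation up to time \<open>n\<close> only, which suffices as every fixed time is
  reached eventually.\<close>

theorem peano_existence:
  assumes \<xi>: "\<And>j. continuous_on UNIV (\<xi> j)"
  shows "\<exists>x. (\<forall>i. continuous_on UNIV (x i)) \<and>
    (\<forall>i t. x i t = \<xi> i (min t 0) + integral {0..t} (V x i))"
proof -
  define h where "h = (\<lambda>n. inverse (real (Suc n)))"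
  have h: "h n > 0" "h \<longlonglongrightarrow> 0" for n
    using LIMSEQ_inverse_real_of_nat by (simp_all add: h_def)
  have "\<exists>X. \<forall>n. (\<forall>i. continuous_on UNIV (X n i)) \<and>
     (\<forall>i. B-lipschitz_on UNIV (\<lambda>t. X n i t - \<xi> i (min t 0))) \<and>
     (\<forall>i. X n i 0 = \<xi> i 0) \<and> (\<forall>i. \<forall>t\<le>real n. X n i t = delayed_step \<xi> (h n) (X n) i t)"
    by (rule choice) (intro allI tonelli_approximation[OF \<xi> h(1)])
  then obtain X where X: "\<And>n i. continuous_on UNIV (X n i)"
     "\<And>n i. B-lipschitz_on UNIV (\<lambda>t. X n i t - \<xi> i (min t 0))"
     "\<And>n i. X n i 0 = \<xi> i 0" "\<And>n i t. t \<le> real n \<Longrightarrow> X n i t = delayed_step \<xi> (h n) (X n) i t"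
    by blast
  define J where "J n i t = X n i t - \<xi> i (min t 0)" for n i t
  have lip: "B-lipschitz_on UNIV (J n i)" for n i unfolding J_def by (rule X)
  obtain k l where k: "strict_mono k" and l: "\<And>i t. (\<lambda>n. J (k n) i t) \<longlonglongrightarrow> l i t"
  proof (rule equi_lipschitz_convergent_subsequence[of B J, OF lip])
    show "J n i 0 = 0" for n i by (simp add: J_def X(3))
  qed blast
  have B: "B \<ge> 0" using bounded[of 0] norm_ge_zero order_trans by blast
  have d: "norm (J n i s - J n i t) \<le> B * \<bar>s - t\<bar>" for n i s t
    using lipschitz_onD[OF lip, of s t n i] by (simp add: dist_norm)
  have lipl: "B-lipschitz_on UNIV (l i)" for i
  proof (rule lipschitz_onI[OF _ B])
    fix s t
    have "(\<lambda>n. norm (J (k n) i s - J (k n) i t)) \<longlonglongrightarrow> norm (l i s - l i t)"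
      by (intro tendsto_intros l)
    then show "dist (l i s) (l i t) \<le> B * dist s t"
      unfolding dist_norm real_norm_def by (rule LIMSEQ_le_const2) (use d in blast)
  qed
  define x where "x i t = \<xi> i (min t 0) + l i t" for i t
  have cont: "continuous_on UNIV (x i)" for i
    unfolding x_def
    by (intro continuous_on_add continuous_clamped \<xi> lipschitz_on_continuous_on[OF lipl])
  have hk: "(\<lambda>n. h (k n)) \<longlonglongrightarrow> 0"
    using LIMSEQ_subseq_LIMSEQ[OF h(2) k] by (simp add: o_def)
  have conv: "(\<lambda>n. X (k n) j (s - h (k n))) \<longlonglongrightarrow> x j s" for j s
  proof -
    have "(\<lambda>n. s - h (k n)) \<longlonglongrightarrow> s - 0" by (intro tendsto_intros hk)
    then have "(\<lambda>n. \<xi> j (min (s - h (k n)) 0)) \<longlonglongrightarrow> \<xi> j (min (s - 0) 0)"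
      by (rule continuous_on_tendsto_compose[OF continuous_clamped[OF \<xi>]]) auto
    then have "(\<lambda>n. \<xi> j (min (s - h (k n)) 0)) \<longlonglongrightarrow> \<xi> j (min s 0)" by simp
    moreover have "(\<lambda>n. J (k n) j (s - h (k n)) - J (k n) j s) \<longlonglongrightarrow> 0"
    proof (rule Lim_null_comparison)
      show "\<forall>\<^sub>F n in sequentially. norm (J (k n) j (s - h (k n)) - J (k n) j s) \<le> B * h (k n)"
      proof (intro always_eventually allI)
        fix n
        show "norm (J (k n) j (s - h (k n)) - J (k n) j s) \<le> B * h (k n)"
          using d[of "k n" j "s - h (k n)" s] h(1)[of "k n"] by simp
      qed
      show "(\<lambda>n. B * h (k n)) \<longlonglongrightarrow> 0" using tendsto_mult_right_zero[OF hk] by simp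
    qed
    ultimately have "(\<lambda>n. \<xi> j (min (s - h (k n)) 0) + ((J (k n) j (s - h (k n)) - J (k n) j s) + J (k n) j s))
        \<longlonglongrightarrow> \<xi> j (min s 0) + (0 + l j s)"
      by (intro tendsto_add l)
    then show ?thesis by (simp add: x_def J_def)
  qed
  have "x i t = \<xi> i (min t 0) + integral {0..t} (V x i)" for i t
  proof -
    define g where "g n = V (\<lambda>j s. X (k n) j (s - h (k n))) i" for n
    have "(\<lambda>n. integral {0..t} (g n)) \<longlonglongrightarrow> integral {0..t} (V x i)"
    proof (rule dominated_convergence(2))
      show "g n integrable_on {0..t}" for n
        unfolding g_def
        by (intro integrable_continuous_real continuous_on_subset[OF delayed_field_continuous[OF X(1)]]) auto
      show "(\<lambda>_. B) integrable_on {0..t}" by (rule integrable_const_ivl)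
      show "norm (g n s) \<le> B" if "s \<in> {0..t}" for n s
        unfolding g_def using that by (intro bounded) auto
      show "(\<lambda>n. g n s) \<longlonglongrightarrow> V x i s" if "s \<in> {0..t}" for s
        unfolding g_def using that by (intro seq_continuous conv) auto
    qed
    moreover have "\<forall>\<^sub>F n in sequentially. integral {0..t} (g n) = J (k n) i t"
    proof -
      obtain n0 :: nat where n0: "t \<le> real n0" using real_arch_simple by blast
      show ?thesis
      proof (rule eventually_sequentiallyI[of n0])
        fix n assume "n0 \<le> n"
        then have "t \<le> real (k n)" using n0 seq_suble[OF k, of n] by linarith
        from X(4)[OF this, of i] show "integral {0..t} (g n) = J (k n) i t"
          by (simp add: J_def delayed_step_def g_def)
      qed
    qed
    ultimately have "(\<lambda>n. J (k n) i t) \<longlonglongrightarrow> integral {0..t} (V x i)"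
      by (rule Lim_transform_eventually)
    then have "l i t = integral {0..t} (V x i)" using l LIMSEQ_unique by blast
    then show ?thesis by (simp add: x_def)
  qed
  with cont show ?thesis by blast
qed

end

section \<open>A priori estimates for the agents\<close>

locale leader_follower =
  fixes N :: nat and \<gamma> \<tau>b :: real and \<tau> a \<phi> :: "real \<Rightarrow> real"
  assumes \<gamma>_pos: "\<gamma> > 0" and \<tau>b_nonneg: "\<tau>b \<ge> 0"
    and \<tau>_cont: "continuous_on {0..} \<tau>" and \<tau>_range: "\<And>t. t \<ge> 0 \<Longrightarrow> 0 \<le> \<tau> t \<and> \<tau> t \<le> \<tau>b"
    and a_cont: "continuous_on {0..} a" and a_range: "\<And>s. s \<ge> 0 \<Longrightarrow> 0 \<le> a s \<and> a s \<le> 1"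
    and \<phi>_cont: "continuous_on {0..} \<phi>" and \<phi>_antimono: "antimono_on {0..} \<phi>"
    and \<phi>_range: "\<And>s. s \<ge> 0 \<Longrightarrow> 0 < \<phi> s \<and> \<phi> s \<le> 1"
begin

abbreviation vel :: "(nat \<Rightarrow> real \<Rightarrow> 'a::euclidean_space) \<Rightarrow> nat \<Rightarrow> real \<Rightarrow> 'a"
  where "vel \<equiv> agent_velocity N \<gamma> \<tau> a \<phi>"

lemma velocity_continuous:
  fixes x :: "nat \<Rightarrow> real \<Rightarrow> 'a::euclidean_space"
  assumes x: "\<And>j. j \<le> N \<Longrightarrow> continuous_on {-\<tau>b..} (x j)" and i: "continuous_on {-\<tau>b..} (x i)"
  shows "continuous_on {0..} (vel x i)"
proof -
  have xt: "continuous_on {0..} (\<lambda>t. x j (t - \<tau> t))" if "j \<le> N" for j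
    by (rule continuous_on_compose2[OF x[OF that]]) (use \<tau>_range in \<open>force intro!: continuous_intros \<tau>_cont\<close>)+
  have xi: "continuous_on {0..} (x i)"
    using \<tau>b_nonneg by (intro continuous_on_subset[OF i]) auto
  have d: "continuous_on {0..} (\<lambda>t. x j (t - \<tau> t) - x i t)" if "j \<le> N" for j
    by (intro continuous_intros xt xi that)
  have "continuous_on {0..} (\<lambda>t. a (norm (x j (t - \<tau> t) - x i t)))"
       "continuous_on {0..} (\<lambda>t. \<phi> (norm (x j (t - \<tau> t) - x i t)))" if "j \<le> N" for j
    by (auto intro!: continuous_on_compose2[OF a_cont] continuous_on_compose2[OF \<phi>_cont] continuous_on_norm d that)
  then show ?thesis
    unfolding agent_velocity_def by (intro continuous_intros d) auto
qed

text \<open>The maximum principle behind all estimates: the outward velocity of an agent at distance \<open>m\<close>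
  from \<open>p\<close>. Since \<open>0 \<le> a \<le> 1\<close> and at most \<open>N\<close> neighbours are averaged with weight \<open>1 / N\<close>, the
  other agents contribute no more than a single agent at distance \<open>m'\<close> would.\<close>

lemma velocity_inner_le:
  fixes x :: "nat \<Rightarrow> real \<Rightarrow> 'a::euclidean_space"
  assumes m: "norm (x i t - p) = m" and mm: "m \<le> m'"
    and x: "\<And>j. j \<in> {1..N} \<Longrightarrow> norm (x j (t - \<tau> t) - p) \<le> m'"
  shows "(x i t - p) \<bullet> vel x i t \<le> m * (m' - m)
    + \<gamma> * \<phi> (norm (x 0 (t - \<tau> t) - x i t)) * ((x i t - p) \<bullet> (x 0 (t - \<tau> t) - p) - m\<^sup>2)"
proof -
  have m0: "m \<ge> 0" using m by auto
  have split: "(x i t - p) \<bullet> (z - x i t) = (x i t - p) \<bullet> (z - p) - m\<^sup>2" for z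
  proof -
    have "(x i t - p) \<bullet> (z - x i t) = (x i t - p) \<bullet> (z - p) - (x i t - p) \<bullet> (x i t - p)"
      by (simp add: inner_diff_right)
    then show ?thesis by (simp add: m[symmetric] power2_norm_eq_inner)
  qed
  let ?s = "\<Sum>j\<in>{1..N} - {i}. a (norm (x j (t - \<tau> t) - x i t)) *\<^sub>R (x j (t - \<tau> t) - x i t)"
  have "(x i t - p) \<bullet> ?s = (\<Sum>j\<in>{1..N} - {i}. a (norm (x j (t - \<tau> t) - x i t)) * ((x i t - p) \<bullet> (x j (t - \<tau> t) - x i t)))"
    by (simp add: inner_sum_right)
  also have "\<dots> \<le> (\<Sum>j\<in>{1..N} - {i}. m * (m' - m))"
  proof (rule sum_mono)
    fix j assume j: "j \<in> {1..N} - {i}"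
    have "(x i t - p) \<bullet> (x j (t - \<tau> t) - p) \<le> m * norm (x j (t - \<tau> t) - p)"
      using norm_cauchy_schwarz m by blast
    also have "\<dots> \<le> m * m'" using x j m0 by (intro mult_left_mono) auto
    finally have "(x i t - p) \<bullet> (x j (t - \<tau> t) - x i t) \<le> m * (m' - m)"
      unfolding split power2_eq_square right_diff_distrib by simp
    then have "a (norm (x j (t - \<tau> t) - x i t)) * ((x i t - p) \<bullet> (x j (t - \<tau> t) - x i t))
        \<le> a (norm (x j (t - \<tau> t) - x i t)) * (m * (m' - m))"
      using a_range by (intro mult_left_mono) auto
    also have "\<dots> \<le> 1 * (m * (m' - m))"
      using a_range m0 mm by (intro mult_right_mono) auto
    finally show "a (norm (x j (t - \<tau> t) - x i t)) * ((x i t - p) \<bullet> (x j (t - \<tau> t) - x i t)) \<le> m * (m' - m)"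
      by simp
  qed
  also have "\<dots> = real (card ({1..N} - {i})) * (m * (m' - m))" by simp
  also have "\<dots> \<le> real N * (m * (m' - m))"
    using card_mono[of "{1..N}" "{1..N} - {i}"] m0 mm by (intro mult_right_mono) auto
  finally have "(x i t - p) \<bullet> ?s \<le> real N * (m * (m' - m))" .
  then have "(1 / real N) * ((x i t - p) \<bullet> ?s) \<le> m * (m' - m)"
  proof (cases "N = 0")
    case False
    then show ?thesis using \<open>(x i t - p) \<bullet> ?s \<le> real N * (m * (m' - m))\<close> by (simp add: field_simps)
  qed (use m0 mm in simp)
  then show ?thesis
    unfolding agent_velocity_def by (simp add: inner_add_right split)
qed

text \<open>The constant \<open>K\<close> is a barrier: at contact the other agents cannot push outwards, and the leader,
  being strictly inside, pulls inwards. The velocity equation is only required as long as the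
  agents have stayed in the closed ball, so that the lemma also applies to a system modified
  outside that ball.\<close>

lemma agents_bounded:
  fixes x :: "nat \<Rightarrow> real \<Rightarrow> 'a::euclidean_space"
  assumes cont: "\<And>j. j \<in> {1..N} \<Longrightarrow> continuous_on {0..} (x j)"
    and der: "\<And>j t. \<lbrakk>j \<in> {1..N}; t > 0\<rbrakk> \<Longrightarrow> (x j has_vector_derivative x' j t) (at t)"
    and leader: "\<And>s. s \<ge> -\<tau>b \<Longrightarrow> norm (x 0 s) < K"
    and init: "\<And>j s. \<lbrakk>j \<in> {1..N}; -\<tau>b \<le> s; s \<le> 0\<rbrakk> \<Longrightarrow> norm (x j s) < K"
    and velocity: "\<And>i t. \<lbrakk>i \<in> {1..N}; t > 0; \<And>j s. \<lbrakk>j \<in> {1..N}; -\<tau>b \<le> s; s \<le> t\<rbrakk> \<Longrightarrow> norm (x j s) \<le> K\<rbrakk>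
      \<Longrightarrow> x' i t = vel x i t"
    and j: "j \<in> {1..N}" and s: "s \<ge> -\<tau>b"
  shows "norm (x j s) < K"
proof (cases "s \<le> 0")
  case False
  have K: "K > 0" using leader[of 0] \<tau>b_nonneg le_less_trans[OF norm_ge_zero] by auto
  show ?thesis
  proof (rule norm_below_barrier[of "{1..N}" 0 x "\<lambda>_. K" "\<lambda>_. 0" x'])
    fix i t
    assume i: "i \<in> {1..N}" and t: "t > 0" and eq: "norm (x i t) = K"
      and le: "\<And>j s. \<lbrakk>j \<in> {1..N}; 0 \<le> s; s \<le> t\<rbrakk> \<Longrightarrow> norm (x j s) \<le> K"
    have le': "norm (x j s) \<le> K" if "j \<in> {1..N}" "-\<tau>b \<le> s" "s \<le> t" for j s
      using le[of j s] init[of j s] that by (cases "s \<le> 0") auto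
    have \<tau>t: "-\<tau>b \<le> t - \<tau> t" "t - \<tau> t \<le> t" using \<tau>_range[of t] t by auto
    define z where "z = x 0 (t - \<tau> t)"
    define f where "f = \<gamma> * \<phi> (norm (z - x i t))"
    have f: "f > 0" using \<gamma>_pos \<phi>_range by (simp add: f_def)
    have "x i t \<bullet> z \<le> K * norm z" using norm_cauchy_schwarz[of "x i t" z] eq by simp
    also have "\<dots> < K * K" using leader[OF \<tau>t(1)] K by (simp add: z_def)
    finally have "x i t \<bullet> z - K\<^sup>2 < 0" by (simp add: power2_eq_square)
    then have neg: "f * (x i t \<bullet> z - K\<^sup>2) < 0" using f by (simp add: mult_less_0_iff)
    have "x i t \<bullet> vel x i t \<le> f * (x i t \<bullet> z - K\<^sup>2)"
      using velocity_inner_le[of x i t 0 K K] eq le'[OF _ \<tau>t] by (simp add: f_def z_def)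
    then show "x i t \<bullet> x' i t < K * 0" using neg velocity[OF i t le'] by simp
  qed (use K cont der init[of _ 0] j False \<tau>b_nonneg in auto)
qed (use init j s in auto)

text \<open>The barrier starts at \<open>t0 = T + \<tau>b\<close>, from where on only positions of the resting leader are
  seen. Before \<open>t0\<close> the bound \<open>C\<close>, which is the value of the barrier at \<open>t0\<close>, replaces it.\<close>

lemma agents_converge:
  fixes x :: "nat \<Rightarrow> real \<Rightarrow> 'a::euclidean_space"
  assumes cont: "\<And>j. j \<in> {1..N} \<Longrightarrow> continuous_on {0..} (x j)"
    and der: "\<And>j t. \<lbrakk>j \<in> {1..N}; t > 0\<rbrakk> \<Longrightarrow> (x j has_vector_derivative vel x j t) (at t)"
    and leader: "\<And>s. s \<ge> T \<Longrightarrow> x 0 s = p" and T: "T \<ge> 0"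
    and bd: "\<And>j s. \<lbrakk>j \<in> {1..N}; s \<ge> 0\<rbrakk> \<Longrightarrow> norm (x j s - p) < C"
    and j: "j \<in> {1..N}"
  shows "(x j \<longlongrightarrow> p) at_top"
proof -
  define t0 where "t0 = T + \<tau>b"
  have t0: "t0 \<ge> 0" using T \<tau>b_nonneg by (simp add: t0_def)
  have C: "C > 0" using bd[OF j, of 0] le_less_trans[OF norm_ge_zero] by auto
  define k where "k = \<gamma> * \<phi> C"
  have k: "k > 0" using \<gamma>_pos \<phi>_range[of C] C by (simp add: k_def)
  \<comment> \<open>The inequality \<open>exp (l * \<tau>b) + l < 1 + k\<close> holds at \<open>l = 0\<close>, so that every small \<open>l > 0\<close> is a possible decay rate.\<close>
  have "((\<lambda>l. exp (l * \<tau>b) + l) \<longlongrightarrow> exp (0 * \<tau>b) + 0) (at_right 0)"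
    by (intro tendsto_intros)
  then have "\<forall>\<^sub>F l in at_right 0. exp (l * \<tau>b) + l < 1 + k"
    by (rule order_tendstoD) (use k in simp)
  moreover have "\<forall>\<^sub>F l in at_right 0. (0::real) < l" by (rule eventually_at_right_less)
  ultimately have "\<forall>\<^sub>F l in at_right 0. exp (l * \<tau>b) + l < 1 + k \<and> 0 < l"
    by (rule eventually_conj)
  then obtain l where l: "exp (l * \<tau>b) + l < 1 + k" "0 < l"
    using eventually_happens'[of "at_right (0::real)"] by force
  define v where "v t = C * exp (- l * (t - t0))" for t
  have vpos: "v t > 0" for t using C by (simp add: v_def)
  have lt: "norm (x j t - p) < v t" if "t \<ge> t0" for t
  proof (rule norm_below_barrier[of "{1..N}" t0 "\<lambda>j s. x j s - p" v "\<lambda>t. - l * v t" "vel x"])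
    fix i t
    assume i: "i \<in> {1..N}" and t: "t > t0" and eq: "norm (x i t - p) = v t"
      and le: "\<And>j s. \<lbrakk>j \<in> {1..N}; t0 \<le> s; s \<le> t\<rbrakk> \<Longrightarrow> norm (x j s - p) \<le> v s"
    define E where "E = exp (l * \<tau>b)"
    have \<tau>t: "T \<le> t - \<tau> t" "t - \<tau> t \<le> t" "\<tau> t \<le> \<tau>b" using \<tau>_range[of t] t t0 by (auto simp: t0_def)
    have Ev: "E * v t = C * exp (l * (\<tau>b - (t - t0)))"
      by (simp add: E_def v_def exp_add[symmetric] algebra_simps)
    have le': "norm (x j (t - \<tau> t) - p) \<le> E * v t" if jN: "j \<in> {1..N}" for j
    proof (cases "t - \<tau> t \<ge> t0")
      case True
      then have "norm (x j (t - \<tau> t) - p) \<le> v (t - \<tau> t)" using le jN \<tau>t by simp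
      also have "\<dots> = C * exp (l * (\<tau> t - (t - t0)))" by (simp add: v_def algebra_simps)
      also have "\<dots> \<le> E * v t"
        unfolding Ev using C l \<tau>t by (intro mult_left_mono) (auto intro!: mult_left_mono)
      finally show ?thesis .
    next
      case False
      have "norm (x j (t - \<tau> t) - p) < C * 1" using bd[OF jN, of "t - \<tau> t"] \<tau>t T by simp
      also have "\<dots> \<le> E * v t"
        unfolding Ev using C l \<tau>t False by (intro mult_left_mono) auto
      finally show ?thesis by simp
    qed
    have "v t \<le> E * v t" using l \<tau>b_nonneg vpos[of t] by (simp add: E_def)
    from velocity_inner_le[of x i t p "v t" "E * v t", OF eq this le']
    have "(x i t - p) \<bullet> vel x i t \<le> v t * (E * v t - v t) - \<gamma> * \<phi> (norm (p - x i t)) * (v t)\<^sup>2"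
      using leader[OF \<tau>t(1)] by simp
    also have "\<dots> \<le> v t * (E * v t - v t) - k * (v t)\<^sup>2"
    proof -
      have "norm (p - x i t) \<le> C" using bd[OF i, of t] t t0 by (simp add: norm_minus_commute)
      then have "\<phi> C \<le> \<phi> (norm (p - x i t))"
        using C by (intro monotone_onD[OF \<phi>_antimono]) auto
      then show ?thesis using \<gamma>_pos by (simp add: k_def mult_right_mono)
    qed
    also have "\<dots> = (E - 1 - k) * (v t)\<^sup>2" by (simp add: power2_eq_square algebra_simps)
    also have "\<dots> < - l * (v t)\<^sup>2"
      using l(1) vpos[of t] by (intro mult_strict_right_mono) (auto simp: E_def)
    also have "\<dots> = v t * (- l * v t)" by (simp add: power2_eq_square)
    finally show "(x i t - p) \<bullet> vel x i t < v t * (- l * v t)" .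
  next
    fix t
    show "(v has_real_derivative - l * v t) (at t)"
      unfolding v_def by (auto intro!: derivative_eq_intros)
  next
    fix i assume "i \<in> {1..N}"
    then show "norm (x i t0 - p) < v t0" using bd t0 by (simp add: v_def)
    show "continuous_on {t0..} (\<lambda>s. x i s - p)"
      using t0 by (intro continuous_intros continuous_on_subset[OF cont[OF \<open>i \<in> _\<close>]]) auto
  next
    fix i t assume "i \<in> {1..N}" "t > t0"
    then show "((\<lambda>s. x i s - p) has_vector_derivative vel x i t) (at t)"
      using has_vector_derivative_diff[OF der has_vector_derivative_const[of p]] t0 by fastforce
  qed (use vpos j that in auto)
  have "((\<lambda>t. x j t - p) \<longlongrightarrow> 0) at_top"
  proof (rule Lim_null_comparison)
    show "\<forall>\<^sub>F t in at_top. norm (x j t - p) \<le> v t"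
      using eventually_ge_at_top[of t0] by eventually_elim (use lt in \<open>auto intro: less_imp_le\<close>)
    show "(v \<longlongrightarrow> 0) at_top" unfolding v_def using l(2) by real_asymp
  qed
  then show ?thesis by (simp add: LIM_zero_iff)
qed

text \<open>The velocity is a continuous function of time along any continuous path, so that the integral
  equation upgrades the almost everywhere statement to every time.\<close>

lemma agent_differentiable:
  fixes x :: "nat \<Rightarrow> real \<Rightarrow> 'a::euclidean_space"
  assumes x: "\<And>j. j \<le> N \<Longrightarrow> continuous_on {-\<tau>b..} (x j)" and i: "i \<le> N"
    and ac: "locally_absolutely_continuous (x i)"
    and der: "AE t in lebesgue_on {0..}. (x i has_vector_derivative vel x i t) (at t within {0..})"
    and t: "t \<ge> 0"
  shows "(x i has_vector_derivative vel x i t) (at t within {0..})"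
proof (rule indefinite_integral_has_vector_derivative[OF velocity_continuous[of x i, OF x x[OF i]] t])
  fix s :: real assume "s \<ge> 0"
  from integral_unique[OF locally_absolutely_continuous_has_integral[OF ac der this]]
  show "x i s = x i 0 + integral {0..s} (vel x i)" by simp
qed

section \<open>Existence of agent trajectories for a given leader\<close>

text \<open>Projecting the agents to the ball of radius \<open>K\<close> makes the velocities globally bounded, as
  Peano's theorem assumes. The leader is a given function of time, so its path is inserted in
  place of the component 0, and only the agents are solved for.\<close>

definition clipped :: "real \<Rightarrow> (real \<Rightarrow> 'a) \<Rightarrow> (nat \<Rightarrow> real \<Rightarrow> 'a) \<Rightarrow> nat \<Rightarrow> real \<Rightarrow> 'a::euclidean_space"
  where "clipped K X0 x j s = (if j = 0 then X0 s else closest_point (cball 0 K) (x j s))"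

lemma clipped_velocity_field:
  fixes X0 :: "real \<Rightarrow> 'a::euclidean_space"
  assumes X0: "continuous_on UNIV X0" "\<And>s. norm (X0 s) \<le> K"
  shows "bounded_causal_field (\<lambda>x. vel (clipped K X0 x)) (2 * K * (1 + \<gamma>))"
proof
  have K: "K \<ge> 0" using X0(2) norm_ge_zero order_trans by blast
  have norm_c: "norm (clipped K X0 x j s) \<le> K" for x :: "nat \<Rightarrow> real \<Rightarrow> 'a" and j s
    using closest_point_in_set[of "cball (0::'a) K" "x j s"] K X0(2) by (auto simp: clipped_def)
  have cp: "continuous_on UNIV (closest_point (cball (0::'a) K))"
    using K by (intro continuous_on_closest_point) auto
  fix t :: real and x :: "nat \<Rightarrow> real \<Rightarrow> 'a" and i
  define y where "y = clipped K X0 x"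
  {
    assume t: "t \<ge> 0"
    have d: "norm (y j s - y i t) \<le> 2 * K" for j s
      using norm_triangle_ineq4[of "y j s" "y i t"] norm_c[of x j s] norm_c[of x i t] by (simp add: y_def)
    have "norm (a (norm (y j s - y i t)) *\<^sub>R (y j s - y i t)) \<le> 2 * K" for j s
      using mult_mono[OF conjunct2[OF a_range[of "norm (y j s - y i t)"]] d[of j s]] a_range[of "norm (y j s - y i t)"]
      by simp
    then have "norm (\<Sum>j\<in>{1..N} - {i}. a (norm (y j (t - \<tau> t) - y i t)) *\<^sub>R (y j (t - \<tau> t) - y i t))
        \<le> real (card ({1..N} - {i})) * (2 * K)"
      by (intro order_trans[OF norm_sum] sum_bounded_above)
    also have "\<dots> \<le> real N * (2 * K)"
      using card_mono[of "{1..N}" "{1..N} - {i}"] K by (intro mult_right_mono) auto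
    finally have 1: "norm ((1 / real N) *\<^sub>R (\<Sum>j\<in>{1..N} - {i}. a (norm (y j (t - \<tau> t) - y i t)) *\<^sub>R (y j (t - \<tau> t) - y i t)))
        \<le> 2 * K"
      using K by (cases "N = 0") (auto simp: field_simps)
    have "norm (\<phi> (norm (y 0 (t - \<tau> t) - y i t)) *\<^sub>R (y 0 (t - \<tau> t) - y i t)) \<le> 2 * K"
      using mult_mono[OF conjunct2[OF \<phi>_range[of "norm (y 0 (t - \<tau> t) - y i t)"]] d[of 0 "t - \<tau> t"]]
        \<phi>_range[of "norm (y 0 (t - \<tau> t) - y i t)"]
      by (simp add: less_imp_le)
    then have 2: "norm ((\<gamma> * \<phi> (norm (y 0 (t - \<tau> t) - y i t))) *\<^sub>R (y 0 (t - \<tau> t) - y i t)) \<le> \<gamma> * (2 * K)"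
      using \<gamma>_pos by (simp add: abs_mult)
    show "norm (vel (clipped K X0 x) i t) \<le> 2 * K * (1 + \<gamma>)"
      using norm_triangle_le[OF add_mono[OF 1 2]]
      by (simp add: agent_velocity_def y_def[symmetric] algebra_simps)
  next
    assume x: "\<And>j. continuous_on UNIV (x j)"
    have "continuous_on UNIV (clipped K X0 x j)" for j
      unfolding clipped_def using X0(1) continuous_on_compose2[OF cp x] by (cases "j = 0") auto
    then show "continuous_on {0..} (vel (clipped K X0 x) i)"
      by (intro velocity_continuous) (auto intro: continuous_on_subset)
  next
    fix X :: "nat \<Rightarrow> nat \<Rightarrow> real \<Rightarrow> 'a"
    assume t: "t \<ge> 0" and X: "\<And>j s. s \<le> t \<Longrightarrow> (\<lambda>n. X n j s) \<longlonglongrightarrow> x j s"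
    have c: "(\<lambda>n. clipped K X0 (X n) j s) \<longlonglongrightarrow> clipped K X0 x j s" if "s \<le> t" for j s
      using X[OF that, of j] cp
      by (auto simp: clipped_def continuous_on_eq_continuous_at intro: isCont_tendsto_compose)
    have s: "t - \<tau> t \<le> t" using \<tau>_range[OF t] by simp
    have d: "(\<lambda>n. clipped K X0 (X n) j (t - \<tau> t) - clipped K X0 (X n) i t)
        \<longlonglongrightarrow> clipped K X0 x j (t - \<tau> t) - clipped K X0 x i t" for j
      by (intro tendsto_intros c s order_refl)
    have comp: "(\<lambda>n. f (norm (w n))) \<longlonglongrightarrow> f (norm z)"
      if f: "continuous_on {0..} f" and w: "w \<longlonglongrightarrow> z" for f :: "real \<Rightarrow> real" and w :: "nat \<Rightarrow> 'a" and z
      by (rule continuous_on_tendsto_compose[OF f tendsto_norm[OF w]]) auto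
    show "(\<lambda>n. vel (clipped K X0 (X n)) i t) \<longlonglongrightarrow> vel (clipped K X0 x) i t"
      unfolding agent_velocity_def
      by (intro tendsto_intros comp[OF a_cont d] comp[OF \<phi>_cont d] d)
  }
qed

text \<open>A solution of the clipped system never leaves the ball, by \<open>agents_bounded\<close>, and hence solves
  the original system.\<close>

lemma agents_exist:
  fixes X0 :: "real \<Rightarrow> 'a::euclidean_space"
  assumes X0: "continuous_on UNIV X0" "\<And>s. norm (X0 s) < K"
    and \<xi>: "\<And>j. continuous_on UNIV (\<xi> j)" "\<And>j s. \<lbrakk>j \<in> {1..N}; -\<tau>b \<le> s; s \<le> 0\<rbrakk> \<Longrightarrow> norm (\<xi> j s) < K"
  shows "\<exists>x. x 0 = X0 \<and> (\<forall>j. continuous_on UNIV (x j)) \<and> (\<forall>j\<in>{1..N}. \<forall>s\<le>0. x j s = \<xi> j s) \<and>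
    (\<forall>j\<in>{1..N}. \<exists>B. B-lipschitz_on {0..} (x j)) \<and>
    (\<forall>j\<in>{1..N}. \<forall>t\<ge>0. (x j has_vector_derivative vel x j t) (at t within {0..}))"
proof -
  interpret bounded_causal_field "\<lambda>x. vel (clipped K X0 x)" "2 * K * (1 + \<gamma>)"
    by (rule clipped_velocity_field) (use X0 less_imp_le in auto)
  obtain y where y: "\<And>j. continuous_on UNIV (y j)"
      "\<And>j t. y j t = \<xi> j (min t 0) + integral {0..t} (vel (clipped K X0 y) j)"
    using peano_existence[of \<xi>, OF \<xi>(1)] by blast
  have vcont: "continuous_on {0..} (vel (clipped K X0 y) j)" for j by (rule continuous[OF y(1)])
  have yder: "(y j has_vector_derivative vel (clipped K X0 y) j t) (at t within {0..})" if "t \<ge> 0" for j t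
    by (rule indefinite_integral_has_vector_derivative[OF vcont that, where c = "\<xi> j 0"]) (subst y(2), simp)
  have ylip: "(2 * K * (1 + \<gamma>))-lipschitz_on {0..} (y j)" for j
  proof -
    have "(2 * K * (1 + \<gamma>))-lipschitz_on {0..} (\<lambda>t. integral {0..t} (vel (clipped K X0 y) j))"
      using lipschitz_on_subset[OF lipschitz_indefinite_integral[OF vcont bounded]] by blast
    then show ?thesis
      using y(2)[of j] by (auto simp: lipschitz_on_def dist_norm)
  qed
  define x where "x j = (if j = 0 then X0 else y j)" for j
  have xy: "x j = y j" if "j \<in> {1..N}" for j using that by (simp add: x_def)
  have init: "x j s = \<xi> j s" if "j \<in> {1..N}" "s \<le> 0" for j s
    using that y(2)[of j s] by (cases "s = 0") (auto simp: xy)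
  have unclip: "vel (clipped K X0 y) i t = vel x i t"
    if i: "i \<in> {1..N}" and t: "t \<ge> 0" and le: "\<And>j s. \<lbrakk>j \<in> {1..N}; -\<tau>b \<le> s; s \<le> t\<rbrakk> \<Longrightarrow> norm (x j s) \<le> K"
    for i t
  proof -
    have eq: "clipped K X0 y j s = x j s" if "j \<le> N" "-\<tau>b \<le> s" "s \<le> t" for j s
      using le[of j s] that by (cases "j = 0") (auto simp: clipped_def x_def closest_point_self)
    have "-\<tau>b \<le> t - \<tau> t" "t - \<tau> t \<le> t" "-\<tau>b \<le> t" using \<tau>_range[OF t] t \<tau>b_nonneg by auto
    then show ?thesis
      unfolding agent_velocity_def using i eq by (intro arg_cong2[where f = plus] arg_cong2[where f = scaleR] sum.cong) auto
  qed
  have bd: "norm (x j s) < K" if "j \<in> {1..N}" "s \<ge> -\<tau>b" for j s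
  proof (rule agents_bounded[where x = x and x' = "vel (clipped K X0 y)"])
    show "(x j has_vector_derivative vel (clipped K X0 y) j t) (at t)" if "j \<in> {1..N}" "t > 0" for j t
      using yder[of t j] that at_within_interior[of t "{0..}"] by (simp add: xy)
  qed (use X0 that init \<xi>(2) unclip in \<open>auto simp: xy x_def intro: continuous_on_subset[OF y(1)]\<close>)
  show ?thesis
  proof (intro exI[of _ x] conjI ballI allI impI)
    show "(x j has_vector_derivative vel x j t) (at t within {0..})" if "j \<in> {1..N}" "t \<ge> 0" for j t
      using yder[OF that(2), of j] unclip[OF that] bd that by (simp add: xy less_imp_le)
    show "\<exists>B. B-lipschitz_on {0..} (x j)" if "j \<in> {1..N}" for j
      using ylip xy[OF that] by auto
  qed (use X0 y init in \<open>auto simp: x_def\<close>)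
qed

end

section \<open>The control and the leader's path\<close>

text \<open>The leader's path: the history \<open>q\<close> up to time 0, then the segment from \<open>q 0\<close> to \<open>p\<close> at constant
  speed, and rest at \<open>p\<close> after time 1.\<close>

definition glide :: "(real \<Rightarrow> 'a) \<Rightarrow> 'a \<Rightarrow> real \<Rightarrow> 'a::real_normed_vector"
  where "glide q p t = q (min t 0) + max 0 (min t 1) *\<^sub>R (p - q 0)"

lemma glide_simps:
  "t \<le> 0 \<Longrightarrow> glide q p t = q t"
  "0 \<le> t \<Longrightarrow> t \<le> 1 \<Longrightarrow> glide q p t = q 0 + t *\<^sub>R (p - q 0)"
  "1 \<le> t \<Longrightarrow> glide q p t = p"
  by (auto simp: glide_def)

lemma glide_continuous:
  assumes "continuous_on UNIV q"
  shows "continuous_on UNIV (glide q p)"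
  unfolding glide_def
  by (intro continuous_intros continuous_on_compose2[OF assms]) auto

lemma glide_norm_less:
  assumes q: "\<And>s. s \<le> 0 \<Longrightarrow> norm (q s) < K" and p: "norm p < K"
  shows "norm (glide q p t) < K"
proof -
  consider "t \<le> 0" | "0 \<le> t" "t \<le> 1" | "1 \<le> t" by linarith
  then show ?thesis
  proof cases
    case 2
    have "(1 - t) *\<^sub>R q 0 + t *\<^sub>R p \<in> ball 0 K"
      using 2 q[of 0] p by (intro convexD[OF convex_ball]) auto
    then show ?thesis using 2 by (simp add: glide_simps algebra_simps)
  qed (use q p in \<open>auto simp: glide_simps\<close>)
qed

lemma glide_lipschitz: "(norm (p - q 0))-lipschitz_on {0..} (glide q p)"
proof (rule lipschitz_onI)
  fix s t :: real assume "s \<in> {0..}" "t \<in> {0..}"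
  then have "glide q p s - glide q p t = (min s 1 - min t 1) *\<^sub>R (p - q 0)"
    by (simp add: glide_def scaleR_diff_left min_def)
  then have "dist (glide q p s) (glide q p t) = \<bar>min s 1 - min t 1\<bar> * norm (p - q 0)"
    by (simp add: dist_norm)
  also have "\<dots> \<le> dist s t * norm (p - q 0)"
    by (intro mult_right_mono) (auto simp: dist_real_def)
  finally show "dist (glide q p s) (glide q p t) \<le> norm (p - q 0) * dist s t"
    by (simp add: mult.commute)
qed simp

lemma glide_derivative:
  "AE t in lebesgue_on {0..}. (glide q p has_vector_derivative (if t \<le> 1 then p - q 0 else 0)) (at t within {0..})"
proof -
  have "(glide q p has_vector_derivative (if t \<le> 1 then p - q 0 else 0)) (at t within {0..})"
    if t: "t \<in> {0..} - {0, 1}" for t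
  proof (rule has_vector_derivative_at_within)
    consider "t \<in> {0<..<1}" | "t \<in> {1<..}" using t by force
    then show "(glide q p has_vector_derivative (if t \<le> 1 then p - q 0 else 0)) (at t)"
    proof cases
      case 1
      have "((\<lambda>s. q 0 + s *\<^sub>R (p - q 0)) has_vector_derivative p - q 0) (at t)"
        by (auto intro!: derivative_eq_intros)
      then have "(glide q p has_vector_derivative p - q 0) (at t)"
        by (rule has_vector_derivative_transform_within_open[OF _ open_greaterThanLessThan 1])
          (simp add: glide_simps)
      then show ?thesis using 1 by simp
    next
      case 2
      have "(glide q p has_vector_derivative 0) (at t)"
        by (rule has_vector_derivative_transform_within_open[OF has_vector_derivative_const[of p] open_greaterThan 2])
          (simp add: glide_simps)
      then show ?thesis using 2 by simp
    qed
  qed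
  then show ?thesis
    by (subst AE_lebesgue_on_iff_negligible) (simp, intro exI[of _ "{0, 1}"] conjI ballI, simp)
qed

lemma admissible_glide_control:
  "admissible_control (\<lambda>t. if t \<le> 1 then w else 0 :: 'a::euclidean_space)"
proof -
  have "(\<lambda>t::real. if t \<le> 1 then w else 0) \<in> borel_measurable borel" by measurable
  then have m: "(\<lambda>t::real. if t \<le> 1 then w else 0) \<in> borel_measurable (lebesgue_on {0..})"
    by (intro measurable_restrict_space1 measurable_completion) simp
  then have "(\<lambda>t::real. ereal (norm (if t \<le> 1 then w else 0))) \<in> borel_measurable (lebesgue_on {0..})"
    by measurable
  then have "esssup (lebesgue_on {0..}) (\<lambda>t::real. ereal (norm (if t \<le> 1 then w else 0))) \<le> ereal (norm w + 1)"
    by (rule esssup_I) simp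
  moreover have "norm w + 1 > 0" by (simp add: add_nonneg_pos)
  ultimately show ?thesis using m unfolding admissible_control_def by blast
qed

section \<open>Steering the agents to the target\<close>

theorem theorem3p3:
  fixes N :: nat
    and \<gamma> \<tau>b \<delta> r L R R\<gamma> :: real
    and \<tau> a \<phi> :: "real \<Rightarrow> real"
    and x_init :: "nat \<Rightarrow> real \<Rightarrow> real ^ 'd"
    and xbar :: "real ^ 'd"
  assumes "\<gamma> > 0" and "\<tau>b > 0"
    and "continuous_on {0..} \<tau>" and "\<And>t. t \<ge> 0 \<Longrightarrow> 0 \<le> \<tau> t \<and> \<tau> t \<le> \<tau>b"
    and "0 < \<delta>" and "\<delta> < r"
    and "continuous_on {0..} a" and "antimono_on {0..} a" and "\<And>s. s \<ge> 0 \<Longrightarrow> a s \<ge> 0"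
    and "\<And>s. s \<in> {0..\<delta>} \<Longrightarrow> a s = 1" and "\<And>s. s \<ge> r \<Longrightarrow> a s = 0"
    and "L > 0" and "L-lipschitz_on {0..} \<phi>" and "antimono_on {0..} \<phi>"
    and "\<And>s. s \<ge> 0 \<Longrightarrow> \<phi> s > 0" and "\<phi> 0 = 1"
    and "\<And>i. i \<le> N \<Longrightarrow> continuous_on {-\<tau>b..0} (x_init i)"
    and "R = initial_radius N \<tau>b x_init"
    and "R\<gamma> = \<gamma> * L * R + \<gamma> + 1"
    and "\<tau>b < ln (1 + \<gamma> * \<phi> (2 * R) / (\<gamma> * (1 + 2 * \<gamma>) * \<phi> (2 * R) + 4 * (1 + \<gamma>) * R\<gamma>))"
    and "\<phi> (\<delta> / 2) > 1 / (2 * \<gamma>)"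
  shows "\<exists>u. admissible_control u \<and>
           (\<exists>x. solves_P N \<gamma> \<tau>b \<tau> a \<phi> x_init u x) \<and>
           (\<forall>x. solves_P N \<gamma> \<tau>b \<tau> a \<phi> x_init u x \<longrightarrow>
                (\<forall>i\<in>{0..N}. (x i \<longlongrightarrow> xbar) at_top))"
proof -
  have a_range: "0 \<le> a s \<and> a s \<le> 1" if "s \<ge> 0" for s
    using monotone_onD[OF assms(8), of 0 s] assms(5,9) assms(10)[of 0] that by simp
  have \<phi>_range: "0 < \<phi> s \<and> \<phi> s \<le> 1" if "s \<ge> 0" for s
    using monotone_onD[OF assms(14), of 0 s] assms(15)[OF that] assms(16) that by simp
  interpret leader_follower N \<gamma> \<tau>b \<tau> a \<phi>
    by unfold_locales
      (use assms(1-4,7,14) a_range \<phi>_range lipschitz_on_continuous_on[OF assms(13)] in auto)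
  obtain B where B: "\<And>i s. \<lbrakk>i \<le> N; s \<in> {-\<tau>b..0}\<rbrakk> \<Longrightarrow> norm (x_init i s) \<le> B i"
  proof -
    have "\<exists>B. \<forall>s\<in>{-\<tau>b..0}. norm (x_init i s) \<le> B" if "i \<le> N" for i
      using compact_imp_bounded[OF compact_continuous_image[OF assms(17)[OF that] compact_Icc]]
      by (auto simp: bounded_iff)
    then show ?thesis using that by metis
  qed
  define K where "K = (\<Sum>i\<le>N. \<bar>B i\<bar>) + norm xbar + 1"
  have init_less: "norm (x_init i s) < K" if "i \<le> N" "s \<in> {-\<tau>b..0}" for i s
  proof -
    have "\<bar>B i\<bar> \<le> (\<Sum>i\<le>N. \<bar>B i\<bar>)" using that(1) by (intro member_le_sum) auto
    then show ?thesis using B[OF that] norm_ge_zero[of xbar] unfolding K_def by linarith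
  qed
  have xbar_less: "norm xbar < K" unfolding K_def by (simp add: sum_nonneg add_nonneg_pos)
  \<comment> \<open>The initial data extended constantly to the whole line (and by 0 to indices beyond \<open>N\<close>), as
    the existence theorem takes globally continuous histories.\<close>
  define \<xi> where "\<xi> i s = (if i \<le> N then x_init i (max (-\<tau>b) (min s 0)) else 0)" for i s
  have \<xi>_cont: "continuous_on UNIV (\<xi> i)" for i
    unfolding \<xi>_def using assms(2)
    by (cases "i \<le> N") (auto intro!: continuous_on_compose2[OF assms(17)] continuous_intros)
  have \<xi>_init: "\<xi> i s = x_init i s" if "i \<le> N" "s \<in> {-\<tau>b..0}" for i s
    using that by (simp add: \<xi>_def)
  have \<xi>_less: "norm (\<xi> i s) < K" if "i \<le> N" for i s
    using init_less[OF that] assms(2) that by (simp add: \<xi>_def)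
  define X0 where "X0 = glide (\<xi> 0) xbar"
  define u where "u t = (if t \<le> 1 then xbar - \<xi> 0 0 else 0)" for t :: real
  have X0_der: "AE t in lebesgue_on {0..}. (X0 has_vector_derivative u t) (at t within {0..})"
    unfolding X0_def u_def by (rule glide_derivative)
  have X0_lac: "locally_absolutely_continuous X0"
    unfolding X0_def by (rule lipschitz_imp_locally_absolutely_continuous[OF glide_lipschitz])
  have X0_cont: "continuous_on UNIV X0" unfolding X0_def by (rule glide_continuous[OF \<xi>_cont])
  have X0_less: "norm (X0 s) < K" for s
    unfolding X0_def by (rule glide_norm_less[OF \<xi>_less xbar_less]) simp
  have X0_init: "X0 s = x_init 0 s" if "s \<in> {-\<tau>b..0}" for s
    using that \<xi>_init[of 0 s] by (simp add: X0_def glide_simps)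

  have "\<exists>x. solves_P N \<gamma> \<tau>b \<tau> a \<phi> x_init u x"
  proof -
    obtain x where x0: "x 0 = X0" and xc: "\<And>j. continuous_on UNIV (x j)"
      and xi: "\<And>j s. \<lbrakk>j \<in> {1..N}; s \<le> 0\<rbrakk> \<Longrightarrow> x j s = \<xi> j s"
      and xl: "\<And>j. j \<in> {1..N} \<Longrightarrow> \<exists>B. B-lipschitz_on {0..} (x j)"
      and xd: "\<And>j t. \<lbrakk>j \<in> {1..N}; t \<ge> 0\<rbrakk> \<Longrightarrow> (x j has_vector_derivative vel x j t) (at t within {0..})"
      using agents_exist[of X0 K \<xi>] X0_cont X0_less \<xi>_cont \<xi>_less by (metis atLeastAtMost_iff)
    have "solves_P N \<gamma> \<tau>b \<tau> a \<phi> x_init u x"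
      unfolding solves_P_def
    proof (intro conjI allI impI ballI)
      fix i assume i: "i \<le> N"
      show "continuous_on {-\<tau>b..} (x i)" by (rule continuous_on_subset[OF xc]) simp
      show "locally_absolutely_continuous (x i)"
        using xl[of i] i x0 X0_lac by (cases "i = 0") (auto intro: lipschitz_imp_locally_absolutely_continuous)
      show "x i s = x_init i s" if "s \<in> {-\<tau>b..0}" for s
        using xi[of i s] \<xi>_init[OF i that] X0_init[OF that] x0 i that by (cases "i = 0") auto
    next
      show "AE t in lebesgue_on {0..}. (x 0 has_vector_derivative u t) (at t within {0..})"
        unfolding x0 by (rule X0_der)
    next
      fix i assume "i \<in> {1..N}"
      then show "AE t in lebesgue_on {0..}. (x i has_vector_derivative vel x i t) (at t within {0..})"
        by (intro AE_I2) (simp add: xd)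
    qed
    then show ?thesis by blast
  qed
  moreover have "(x i \<longlongrightarrow> xbar) at_top"
    if x: "solves_P N \<gamma> \<tau>b \<tau> a \<phi> x_init u x" and i: "i \<in> {0..N}" for x i
  proof -
    have xc: "\<And>j. j \<le> N \<Longrightarrow> continuous_on {-\<tau>b..} (x j)"
      and lac: "\<And>j. j \<le> N \<Longrightarrow> locally_absolutely_continuous (x j)"
      and xi: "\<And>j s. \<lbrakk>j \<le> N; s \<in> {-\<tau>b..0}\<rbrakk> \<Longrightarrow> x j s = x_init j s"
      and xd0: "AE t in lebesgue_on {0..}. (x 0 has_vector_derivative u t) (at t within {0..})"
      and xd: "\<And>j. j \<in> {1..N} \<Longrightarrow> AE t in lebesgue_on {0..}. (x j has_vector_derivative vel x j t) (at t within {0..})"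
      using x unfolding solves_P_def by blast+
    \<comment> \<open>The leader of any solution is \<open>X0\<close>: both are absolutely continuous with derivative \<open>u\<close>
      almost everywhere and the same value at 0.\<close>
    have x0: "x 0 t = X0 t" if "t \<ge> -\<tau>b" for t
    proof (cases "t \<ge> 0")
      case True
      have "x 0 t - x 0 0 = X0 t - X0 0"
        using locally_absolutely_continuous_has_integral[OF lac xd0 True]
          locally_absolutely_continuous_has_integral[OF X0_lac X0_der True]
        by (auto intro: has_integral_unique)
      then show ?thesis using xi[of 0 0] X0_init[of 0] assms(2) by simp
    qed (use xi[of 0 t] X0_init[of t] that in simp)
    have der: "(x j has_vector_derivative vel x j t) (at t)" if "j \<in> {1..N}" "t > 0" for j t
      using agent_differentiable[OF xc _ lac xd, of j t] that at_within_interior[of t "{0..}"] by simp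
    have cont: "continuous_on {0..} (x j)" if "j \<in> {1..N}" for j
      using that assms(2) by (intro continuous_on_subset[OF xc]) auto
    have bd: "norm (x j s) < K" if "j \<in> {1..N}" "s \<ge> -\<tau>b" for j s
    proof (rule agents_bounded[OF cont der _ _ _ that])
      show "norm (x 0 s) < K" if "s \<ge> -\<tau>b" for s using x0[OF that] X0_less by simp
      show "norm (x j s) < K" if "j \<in> {1..N}" "-\<tau>b \<le> s" "s \<le> 0" for j s
        using xi[of j s] init_less[of j s] that by simp
    qed auto
    show ?thesis
    proof (cases "i = 0")
      case True
      have "\<forall>\<^sub>F t in at_top. x 0 t = xbar"
        using eventually_ge_at_top[of 1]
      proof eventually_elim
        case (elim t)
        then show ?case using x0[of t] assms(2) by (simp add: X0_def glide_simps)
      qed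
      then show ?thesis using True by (simp add: tendsto_eventually)
    next
      case False
      show ?thesis
      proof (rule agents_converge[OF cont der, where T = 1 and C = "2 * K"])
        show "x 0 s = xbar" if "s \<ge> 1" for s
          using x0[of s] assms(2) that by (simp add: X0_def glide_simps)
        show "norm (x j s - xbar) < 2 * K" if "j \<in> {1..N}" "s \<ge> 0" for j s
          using bd[OF that(1), of s] that(2) assms(2) xbar_less norm_triangle_ineq4[of "x j s" xbar] by simp
      qed (use i False in auto)
    qed
  qed
  ultimately show ?thesis
    using admissible_glide_control[of "xbar - \<xi> 0 0"] unfolding u_def by blast
qed

end
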